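(* Let $1<p<\infty$, let $p'$ be defined by $\frac1p+\frac1{p'}=1$, and let $\mu$ be a positive Borel measure on $[0,1)$. We have: (i) If $\int_{[0,1)}\left(\log\frac{2}{1-t}\right)^{1/p'}\,d\mu(t)<\infty$, then for any given $f\in B^p$, the integral $\int_{[0,1)}\frac{f(t)}{1-tz}\,d\mu(t)$ converges for all $z\in\mathbb D$ and the resulting function $I_\mu(f)$ of $z$ is analytic in $\mathbb D$. (ii) If for any given $f\in B^p$ the integral $\int_{[0,1)}\frac{f(t)}{1-tz}\,d\mu(t)$ converges for all $z\in\mathbb D$ and the resulting function $I_\mu(f)$ of $z$ is analytic in $\mathbb D$, then $\int_{[0,1)}\left(\log\frac{2}{1-t}\right)^{\gamma}\,d\mu(t)<\infty$ for all $\gamma<\frac{1}{p'}$.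
   Context: $\mathbb D=\{z\in\mathbb C:|z|<1\}$, and $dA(z)=\frac{dx\,dy}{\pi}$. For $1<p<\infty$ the analytic Besov space $B^p$ is the set of analytic functions $f$ in $\mathbb D$ with $\|f\|_{B^p}=\left(|f(0)|^p+\rho_p(f)^p\right)^{1/p}<\infty$, where $\rho_p(f)=\left(\int_{\mathbb D}(1-|z|^2)^{p-2}|f'(z)|^p\,dA(z)\right)^{1/p}$. For an analytic function $f$ in $\mathbb D$, $I_\mu(f)(z)=\int_{[0,1)}\frac{f(t)}{1-tz}\,d\mu(t)$ whenever the right-hand side makes sense and defines an analytic function in $\mathbb D$. *)

theory Defs
  imports "HOL-Complex_Analysis.Complex_Analysis"
begin

abbreviation unit_disc :: "complex set" where
  "unit_disc \<equiv> ball 0 1"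

definition disc_area :: "complex measure" where
  "disc_area = scale_measure (ennreal (1 / pi)) (restrict_space lborel unit_disc)"

(* Powers of extended nonnegative reals; only used with a positive exponent,
   for which infinity is sent to infinity. *)
definition ennpowr :: "ennreal \<Rightarrow> real \<Rightarrow> ennreal" where
  "ennpowr x a = (if x = \<infinity> then \<infinity> else ennreal (enn2real x powr a))"

definition besov_rho :: "real \<Rightarrow> (complex \<Rightarrow> complex) \<Rightarrow> ennreal" where
  "besov_rho p f =
     ennpowr (\<integral>\<^sup>+ z. ennreal ((1 - (cmod z)\<^sup>2) powr (p - 2) * cmod (deriv f z) powr p) \<partial>disc_area)
       (1 / p)"

definition besov_norm :: "real \<Rightarrow> (complex \<Rightarrow> complex) \<Rightarrow> ennreal" where
  "besov_norm p f = ennpowr (ennreal (cmod (f 0) powr p) + ennpowr (besov_rho p f) p) (1 / p)"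

(* Elements are total functions on the complex plane; only their values on the
   unit disc matter. *)
definition besov_space :: "real \<Rightarrow> (complex \<Rightarrow> complex) set" where
  "besov_space p = {f. f analytic_on unit_disc \<and> besov_norm p f < \<infinity>}"

definition I_integrand :: "(complex \<Rightarrow> complex) \<Rightarrow> complex \<Rightarrow> real \<Rightarrow> complex" where
  "I_integrand f z t = f (of_real t) / (1 - of_real t * z)"

(* The Bochner integral is 0 by convention where the integral does not converge, so
   this value is meaningful only together with integrability of the integrand. *)
definition I_op :: "real measure \<Rightarrow> (complex \<Rightarrow> complex) \<Rightarrow> complex \<Rightarrow> complex" where
  "I_op \<mu> f z = (\<integral>t. I_integrand f z t \<partial>\<mu>)"

definition I_well_defined :: "real measure \<Rightarrow> (complex \<Rightarrow> complex) \<Rightarrow> bool" where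
  "I_well_defined \<mu> f \<longleftrightarrow>
     (\<forall>z\<in>unit_disc. integrable \<mu> (I_integrand f z)) \<and> I_op \<mu> f analytic_on unit_disc"

end

theory Submission
  imports Defs
begin

text \<open>
  Both parts come down to the growth of Besov functions along the radius \<open>[0, 1)\<close>. Part (i) rests on
  the bound \<open>|f t| \<le> C (log (2 / (1 - t)))\<^sup>1\<^sup>/\<^sup>p\<^sup>'\<close> for every \<open>f\<close> in \<open>B\<^sup>p\<close>: with it the
  hypothesis makes \<open>t \<mapsto> f t\<close> integrable, so all the integrals converge, and
  expanding \<open>1 / (1 - tz)\<close> in a geometric series and integrating termwise exhibits \<open>I_op \<mu> f\<close>
  as a power series. Part (ii) tests the hypothesis, at \<open>z = 0\<close> only, on
  \<open>f z = (log (4 / (1 - z)))\<^sup>\<gamma>\<close>, which belongs to \<open>B\<^sup>p\<close> for \<open>0 \<le> \<gamma> < 1 / p'\<close>.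

  For the growth bound (\<open>besov_growth\<close>), split \<open>[0, 1)\<close> dyadically at the points \<open>1 - 2\<^sup>-\<^sup>n\<close>.
  On the \<open>n\<close>-th piece the oscillation of \<open>f\<close> is at most \<open>2\<^sup>-\<^sup>n\<close> times the supremum of \<open>|f'|\<close>,
  and the mean value inequality over squares (\<open>area_mean_value_square\<close>) bounds that supremum by an area
  average of \<open>|f'|\<close> over a box \<open>Q\<^sub>n\<close> of side comparable to \<open>2\<^sup>-\<^sup>n\<close>, where \<open>1 - |z|\<^sup>2\<close> is also
  comparable to \<open>2\<^sup>-\<^sup>n\<close>. The elementary inequality \<open>x \<le> A + x\<^sup>p A\<^sup>1\<^sup>-\<^sup>p\<close> with \<open>A = 2\<^sup>n M\<close> takes the
  place of Hoelder's inequality: the \<open>n\<close>-th oscillation is at most a constant times \<open>M + M\<^sup>1\<^sup>-\<^sup>p J\<^sub>n\<close>, where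
  \<open>J\<^sub>n\<close> is the contribution of \<open>Q\<^sub>n\<close> to the Besov integral. The boxes overlap at most three times, so summing
  over \<open>n \<le> N\<close> gives \<open>(N + 1) M + M\<^sup>1\<^sup>-\<^sup>p\<close> up to a constant, and \<open>M = (N + 1)\<^sup>-\<^sup>1\<^sup>/\<^sup>p\<close>
  balances the two terms at \<open>(N + 1)\<^sup>1\<^sup>/\<^sup>p\<^sup>'\<close>, where \<open>N + 1\<close> is comparable to \<open>log (2 / (1 - t))\<close>.

  For the test function (\<open>log_sing_powr_in_besov_space\<close>), cut the disc into dyadic shells around \<open>1\<close>. The
  weight \<open>(1 - |z|\<^sup>2)\<^sup>p\<^sup>-\<^sup>2\<close> gives mass \<open>O(r\<^sup>p)\<close> to the part of the disc within distance \<open>r\<close> of \<open>1\<close>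
  (\<open>disc_mass_near_1\<close>), while \<open>|f'|\<^sup>p\<close> is \<open>O(r\<^sup>-\<^sup>p n\<^sup>-\<^sup>(\<^sup>1\<^sup>-\<^sup>\<gamma>\<^sup>)\<^sup>p)\<close> on the shell
  \<open>|1 - z| \<sim> r = 2\<^sup>-\<^sup>n\<close>. The series of \<open>n\<^sup>-\<^sup>(\<^sup>1\<^sup>-\<^sup>\<gamma>\<^sup>)\<^sup>p\<close> converges exactly because \<open>\<gamma> < 1 / p'\<close>.
\<close>

section \<open>Area integrals in Cartesian coordinates and the mean value inequality\<close>

lemma measurable_Complex[measurable]:
  "(\<lambda>v :: real \<times> real. Complex (fst v) (snd v)) \<in> borel_measurable borel"
  by (intro borel_measurable_continuous_onI continuous_intros)

text \<open>Transfers Fubini's theorem from pairs of reals to \<open>complex\<close>: the two measures agree on boxes.\<close>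

lemma lborel_complex_eq_distr:
  "(lborel :: complex measure) = distr (lborel \<Otimes>\<^sub>M lborel) borel (\<lambda>(x, y). Complex x y)"
proof (rule lborel_eqI)
  have m: "(\<lambda>(x, y). Complex x y) \<in> borel_measurable (lborel \<Otimes>\<^sub>M lborel)"
    using measurable_Complex by (simp add: lborel_prod case_prod_beta')
  fix l u :: complex
  assume le: "\<And>b. b \<in> Basis \<Longrightarrow> l \<bullet> b \<le> u \<bullet> b"
  from le[of 1] le[of \<i>] have le': "Re l \<le> Re u" "Im l \<le> Im u"
    by (auto simp: Basis_complex_def)
  have "(\<lambda>(x, y). Complex x y) -` box l u = {Re l<..<Re u} \<times> {Im l<..<Im u}"
    by (auto simp: box_complex_eq)
  hence "emeasure (distr (lborel \<Otimes>\<^sub>M lborel) borel (\<lambda>(x, y). Complex x y)) (box l u)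
      = emeasure (lborel \<Otimes>\<^sub>M lborel) ({Re l<..<Re u} \<times> {Im l<..<Im u})"
    using m by (subst emeasure_distr) (auto simp: space_pair_measure)
  also have "\<dots> = emeasure lborel {Re l<..<Re u} * emeasure lborel {Im l<..<Im u}"
    by (rule lborel.emeasure_pair_measure_Times) auto
  also have "\<dots> = ennreal (\<Prod>b\<in>Basis. (u - l) \<bullet> b)"
    using le' by (simp add: Basis_complex_def ennreal_mult')
  finally show "emeasure (distr (lborel \<Otimes>\<^sub>M lborel) borel (\<lambda>(x, y). Complex x y)) (box l u)
      = ennreal (\<Prod>b\<in>Basis. (u - l) \<bullet> b)" .
qed simp

lemma nn_integral_complex:
  assumes [measurable]: "F \<in> borel_measurable (borel :: complex measure)"
  shows "(\<integral>\<^sup>+z. F z \<partial>lborel) = (\<integral>\<^sup>+x. (\<integral>\<^sup>+y. F (Complex x y) \<partial>lborel) \<partial>lborel)" (is ?xy)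
    and "(\<integral>\<^sup>+z. F z \<partial>lborel) = (\<integral>\<^sup>+y. (\<integral>\<^sup>+x. F (Complex x y) \<partial>lborel) \<partial>lborel)" (is ?yx)
proof -
  let ?C = "\<lambda>v :: real \<times> real. Complex (fst v) (snd v)"
  have m: "(\<lambda>v. F (?C v)) \<in> borel_measurable (lborel \<Otimes>\<^sub>M lborel)"
    unfolding lborel_prod by measurable
  have "(\<integral>\<^sup>+z. F z \<partial>lborel) = (\<integral>\<^sup>+v. F (?C v) \<partial>(lborel \<Otimes>\<^sub>M lborel))"
    by (subst lborel_complex_eq_distr, subst nn_integral_distr)
       (auto simp: case_prod_beta' lborel_prod)
  thus ?xy ?yx
    using lborel.nn_integral_fst[OF m] lborel_pair.nn_integral_snd[OF m]
    by (simp_all add: case_prod_beta')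
qed

lemma norm_integral_le_nn_integral:
  fixes F :: "real \<Rightarrow> complex"
  assumes "continuous_on {a..b} F"
  shows "ennreal (norm (integral {a..b} F)) \<le> (\<integral>\<^sup>+x. ennreal (norm (F x)) * indicator {a..b} x \<partial>lborel)"
proof -
  have i: "(\<lambda>x. norm (F x)) integrable_on {a..b}"
    by (intro integrable_continuous_real continuous_intros assms)
  have "norm (integral {a..b} F) \<le> integral {a..b} (\<lambda>x. norm (F x))"
    using i assms by (intro integral_norm_bound_integral) (auto intro: integrable_continuous_real)
  also have "ennreal (integral {a..b} (\<lambda>x. norm (F x)))
      = (\<integral>\<^sup>+x. ennreal (norm (F x)) * indicator {a..b} x \<partial>lborel)"
    using i by (intro nn_integral_has_integral_lebesgue'[symmetric]) (auto simp: integrable_integral)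
  finally show ?thesis by (simp add: ennreal_leI)
qed

text \<open>Multiplication by \<open>\<i>\<close> turns the horizontal segment into a vertical one.\<close>

lemma contour_integral_linepath_same_Im:
  assumes "Im z = c" "Im z' = c" "Re z = a" "Re z' = b" "a < b"
  shows   "contour_integral (linepath z z') f = integral {a..b} (\<lambda>x. f (Complex x c))"
proof -
  have lin: "- (\<i> * linepath (\<i> * z) (\<i> * z') x) = linepath z z' x" for x
    by (simp add: linepath_def scaleR_conv_of_real algebra_simps)
  have "contour_integral (linepath (\<i> * z) (\<i> * z')) (\<lambda>w. f (w / \<i>))
      = \<i> * contour_integral (linepath z z') f"
    by (simp add: contour_integral_integral lin algebra_simps flip: integral_mult_right)
  moreover have "contour_integral (linepath (\<i> * z) (\<i> * z')) (\<lambda>w. f (w / \<i>))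
      = \<i> * integral {a..b} (\<lambda>x. f (Complex (-c) x / \<i>))"
    using assms by (intro contour_integral_linepath_same_Re) auto
  moreover have "Complex (-c) x / \<i> = Complex x c" for x
    by (simp add: complex_eq_iff Re_divide Im_divide)
  ultimately show ?thesis by simp
qed

lemma norm_contour_integral_vertical_le:
  assumes "continuous_on (closed_segment (Complex c a) (Complex c b)) f" "a < b"
  shows "ennreal (norm (contour_integral (linepath (Complex c a) (Complex c b)) f))
      \<le> (\<integral>\<^sup>+y. ennreal (norm (f (Complex c y))) * indicator {a..b} y \<partial>lborel)"
proof -
  have "continuous_on {a..b} (\<lambda>y. f (Complex c y))"
    using assms
    by (intro continuous_on_compose2[OF assms(1)] continuous_intros)
       (auto simp: closed_segment_same_Re closed_segment_eq_real_ivl)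
  from norm_integral_le_nn_integral[OF this] show ?thesis
    using assms(2) by (subst contour_integral_linepath_same_Re[where a=a and b=b and c=c])
       (auto simp: norm_mult)
qed

lemma norm_contour_integral_horizontal_le:
  assumes "continuous_on (closed_segment (Complex a c) (Complex b c)) f" "a < b"
  shows "ennreal (norm (contour_integral (linepath (Complex a c) (Complex b c)) f))
      \<le> (\<integral>\<^sup>+x. ennreal (norm (f (Complex x c))) * indicator {a..b} x \<partial>lborel)"
proof -
  have "continuous_on {a..b} (\<lambda>y. f (Complex y c))"
    using assms
    by (intro continuous_on_compose2[OF assms(1)] continuous_intros)
       (auto simp: closed_segment_same_Im closed_segment_eq_real_ivl)
  from norm_integral_le_nn_integral[OF this] show ?thesis
    using assms(2) by (subst contour_integral_linepath_same_Im[where a=a and b=b and c=c]) auto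
qed

definition square :: "complex \<Rightarrow> real \<Rightarrow> complex set" where
  "square s r = cbox (s - Complex r r) (s + Complex r r)"

lemma in_square_iff: "w \<in> square s r \<longleftrightarrow> \<bar>Re w - Re s\<bar> \<le> r \<and> \<bar>Im w - Im s\<bar> \<le> r"
  by (auto simp: square_def in_cbox_complex_iff)

lemma measurable_norm_indicator:
  fixes g :: "complex \<Rightarrow> complex"
  assumes "continuous_on A g" "A \<in> sets borel"
  shows "(\<lambda>w. ennreal (norm (g w)) * indicator A w) \<in> borel_measurable borel"
proof -
  have "(\<lambda>w. ennreal (norm (indicator A w *\<^sub>R g w))) \<in> borel_measurable borel"
    using borel_measurable_continuous_on_indicator[OF assms(2,1)] by measurable
  also have "(\<lambda>w. ennreal (norm (indicator A w *\<^sub>R g w))) = (\<lambda>w. ennreal (norm (g w)) * indicator A w)"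
    by (auto simp: indicator_def)
  finally show ?thesis .
qed

text \<open>Cauchy's formula on the boundary of the square with centre \<open>s\<close>, where \<open>|w - s| \<ge> r\<close>. The four sides
  appear as integrals over full lines of a function \<open>F\<close> that vanishes off the square; in this form they can
  be integrated over \<open>r\<close> by Fubini's theorem.\<close>

lemma Cauchy_square:
  assumes "g holomorphic_on square s r" "0 < r"
  defines "F \<equiv> \<lambda>w. ennreal (norm (g w)) * indicator (square s r) w"
  shows "ennreal (2 * pi * r * norm (g s)) \<le>
      (\<integral>\<^sup>+y. F (Complex (Re s - r) y) \<partial>lborel) + (\<integral>\<^sup>+y. F (Complex (Re s + r) y) \<partial>lborel)
    + (\<integral>\<^sup>+x. F (Complex x (Im s - r)) \<partial>lborel) + (\<integral>\<^sup>+x. F (Complex x (Im s + r)) \<partial>lborel)"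
proof -
  define x0 x1 y0 y1 where "x0 = Re s - r" "x1 = Re s + r" "y0 = Im s - r" "y1 = Im s + r"
  note xy = this
  have corner: "s - Complex r r = Complex x0 y0" "s + Complex r r = Complex x1 y1"
    by (simp_all add: xy complex_eq_iff)
  have lt: "x0 < x1" "y0 < y1" using assms(2) by (auto simp: xy)
  have int: "s \<in> box (Complex x0 y0) (Complex x1 y1)"
    using assms(2) by (auto simp: in_box_complex_iff xy)
  have img: "path_image (rectpath (Complex x0 y0) (Complex x1 y1)) \<subseteq> square s r - {s}"
    using lt int path_image_rectpath_subset_cbox[of "Complex x0 y0" "Complex x1 y1"]
      path_image_rectpath_inter_box[of "Complex x0 y0" "Complex x1 y1"]
    by (auto simp: square_def corner)
  have "((\<lambda>w. g w / (w - s)) has_contour_integral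
      (2 * pi * \<i> * winding_number (rectpath (Complex x0 y0) (Complex x1 y1)) s * g s))
      (rectpath (Complex x0 y0) (Complex x1 y1))"
    using assms(1) int img
    by (intro Cauchy_integral_formula_convex_simple[where S = "square s r"])
       (auto simp: square_def interior_cbox corner)
  hence cif: "contour_integral (rectpath (Complex x0 y0) (Complex x1 y1)) (\<lambda>w. g w / (w - s))
      = 2 * pi * \<i> * g s"
    using int by (simp add: winding_number_rectpath contour_integral_unique)
  let ?h = "\<lambda>w. g w / (w - s)"
  let ?v = "\<lambda>x. contour_integral (linepath (Complex x y0) (Complex x y1)) ?h"
  let ?u = "\<lambda>y. contour_integral (linepath (Complex x0 y) (Complex x1 y)) ?h"
  have cont: "continuous_on S ?h" if "S \<subseteq> square s r - {s}" for S
    using that holomorphic_on_imp_continuous_on[OF assms(1)]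
    by (intro continuous_intros) (auto intro: continuous_on_subset)
  have vseg: "closed_segment (Complex x y0) (Complex x y1) \<subseteq> square s r - {s}" if "x \<in> {x0, x1}" for x
    using that lt assms(2)
    by (auto simp: closed_segment_same_Re closed_segment_eq_real_ivl in_square_iff xy)
  have hseg: "closed_segment (Complex x0 y) (Complex x1 y) \<subseteq> square s r - {s}" if "y \<in> {y0, y1}" for y
    using that lt assms(2)
    by (auto simp: closed_segment_same_Im closed_segment_eq_real_ivl in_square_iff xy)
  have bseg: "closed_segment (Complex x1 y1) (Complex x0 y1) \<subseteq> square s r - {s}"
      "closed_segment (Complex x0 y1) (Complex x0 y0) \<subseteq> square s r - {s}"
    using hseg[of y1] vseg[of x0] by (subst closed_segment_commute, simp)+
  have ci: "?h contour_integrable_on linepath (Complex x0 y0) (Complex x1 y0)"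
      "?h contour_integrable_on linepath (Complex x1 y0) (Complex x1 y1)"
      "?h contour_integrable_on linepath (Complex x1 y1) (Complex x0 y1)"
      "?h contour_integrable_on linepath (Complex x0 y1) (Complex x0 y0)"
    using hseg[of y0] hseg[of y1] vseg[of x0] vseg[of x1] bseg
    by (intro contour_integrable_continuous_linepath cont; simp)+
  have rev: "contour_integral (linepath (Complex x1 y1) (Complex x0 y1)) ?h = - ?u y1"
      "contour_integral (linepath (Complex x0 y1) (Complex x0 y0)) ?h = - ?v x0"
    using bseg by (intro contour_integral_reverse_linepath cont; simp)+
  have "contour_integral (rectpath (Complex x0 y0) (Complex x1 y1)) ?h
     = ?u y0 + (?v x1 + (- ?u y1 + - ?v x0))"
    using ci by (simp add: rectpath_def Let_def rev)
  hence "2 * pi * \<i> * g s = ?u y0 + (?v x1 + (- ?u y1 + - ?v x0))"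
    using cif by simp
  hence "norm (2 * pi * \<i> * g s) = norm (?u y0 + (?v x1 + (- ?u y1 + - ?v x0)))"
    by (rule arg_cong)
  hence "2 * pi * norm (g s) = norm (?u y0 + (?v x1 + (- ?u y1 + - ?v x0)))"
    by (simp add: norm_mult)
  also have "\<dots> \<le> norm (?u y0) + norm (?v x1) + norm (?u y1) + norm (?v x0)"
    using norm_triangle_ineq[of "?u y0" "?v x1 + (- ?u y1 + - ?v x0)"]
      norm_triangle_ineq[of "?v x1" "- ?u y1 + - ?v x0"] norm_triangle_ineq[of "- ?u y1" "- ?v x0"]
    unfolding norm_minus_cancel by linarith
  finally have main: "2 * pi * norm (g s) \<le> norm (?v x0) + norm (?v x1) + norm (?u y0) + norm (?u y1)"
    by simp
  have side: "ennreal (norm (?h w)) \<le> ennreal (1 / r) * F w"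
    if "\<bar>Re w - Re s\<bar> = r \<or> \<bar>Im w - Im s\<bar> = r" "w \<in> square s r" for w
  proof -
    have "r \<le> norm (w - s)"
      using that(1) abs_Re_le_cmod[of "w - s"] abs_Im_le_cmod[of "w - s"] by auto
    hence "norm (?h w) \<le> 1 / r * norm (g w)"
      using assms(2) by (simp add: norm_divide frac_le)
    thus ?thesis
      using that(2) assms(2) by (simp add: F_def ennreal_leI flip: ennreal_mult')
  qed
  have [measurable]: "F \<in> borel_measurable borel"
    unfolding F_def using assms(1)
    by (intro measurable_norm_indicator) (auto simp: square_def holomorphic_on_imp_continuous_on)
  have Cm[measurable]: "(\<lambda>y. Complex x y) \<in> borel_measurable borel"
       "(\<lambda>x. Complex x y) \<in> borel_measurable borel" for x y
    by (intro borel_measurable_continuous_onI continuous_intros)+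
  have v: "ennreal (norm (?v x)) \<le> ennreal (1 / r) * (\<integral>\<^sup>+y. F (Complex x y) \<partial>lborel)"
    if "x \<in> {x0, x1}" for x
  proof -
    have "ennreal (norm (?v x)) \<le> (\<integral>\<^sup>+y. ennreal (norm (?h (Complex x y))) * indicator {y0..y1} y \<partial>lborel)"
      using vseg[OF that] lt by (intro norm_contour_integral_vertical_le cont)
    also have "\<dots> \<le> (\<integral>\<^sup>+y. ennreal (1 / r) * F (Complex x y) \<partial>lborel)"
      using that assms(2)
      by (intro nn_integral_mono) (auto simp: indicator_def in_square_iff xy intro!: side)
    finally show ?thesis by (simp add: nn_integral_cmult)
  qed
  have u: "ennreal (norm (?u y)) \<le> ennreal (1 / r) * (\<integral>\<^sup>+x. F (Complex x y) \<partial>lborel)"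
    if "y \<in> {y0, y1}" for y
  proof -
    have "ennreal (norm (?u y)) \<le> (\<integral>\<^sup>+x. ennreal (norm (?h (Complex x y))) * indicator {x0..x1} x \<partial>lborel)"
      using hseg[OF that] lt by (intro norm_contour_integral_horizontal_le cont)
    also have "\<dots> \<le> (\<integral>\<^sup>+x. ennreal (1 / r) * F (Complex x y) \<partial>lborel)"
      using that assms(2)
      by (intro nn_integral_mono) (auto simp: indicator_def in_square_iff xy intro!: side)
    finally show ?thesis by (simp add: nn_integral_cmult)
  qed
  have "ennreal (2 * pi * norm (g s))
      \<le> ennreal (norm (?v x0)) + ennreal (norm (?v x1)) + ennreal (norm (?u y0)) + ennreal (norm (?u y1))"
    using main by (simp add: ennreal_leI flip: ennreal_plus)
  also have "\<dots> \<le> ennreal (1 / r) * (\<integral>\<^sup>+y. F (Complex x0 y) \<partial>lborel)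
      + ennreal (1 / r) * (\<integral>\<^sup>+y. F (Complex x1 y) \<partial>lborel)
      + ennreal (1 / r) * (\<integral>\<^sup>+x. F (Complex x y0) \<partial>lborel)
      + ennreal (1 / r) * (\<integral>\<^sup>+x. F (Complex x y1) \<partial>lborel)"
    by (intro add_mono u v) auto
  finally have "ennreal r * ennreal (2 * pi * norm (g s)) \<le> ennreal r * (ennreal (1 / r) *
      ((\<integral>\<^sup>+y. F (Complex x0 y) \<partial>lborel) + (\<integral>\<^sup>+y. F (Complex x1 y) \<partial>lborel)
      + (\<integral>\<^sup>+x. F (Complex x y0) \<partial>lborel) + (\<integral>\<^sup>+x. F (Complex x y1) \<partial>lborel)))"
    by (intro mult_left_mono) (auto simp: distrib_left)
  moreover have "ennreal r * ennreal (2 * pi * norm (g s)) = ennreal (2 * pi * r * norm (g s))"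
    using assms(2) by (simp add: mult_ac flip: ennreal_mult')
  moreover have "ennreal r * (ennreal (1 / r) * X) = X" for X
    using assms(2) by (simp add: mult.assoc[symmetric] flip: ennreal_mult')
  ultimately show ?thesis by (simp add: xy)
qed

text \<open>Averaging Cauchy's formula over the squares of half side \<open>r \<in> [d/2, d]\<close>: as \<open>r\<close> varies, each of the
  four sides sweeps out a part of the large square once, so it contributes at most the area integral of \<open>|g|\<close>.
  Squares, unlike discs, need no polar coordinates.\<close>

lemma area_mean_value_square:
  assumes "g holomorphic_on square s d" "0 < d"
  shows "ennreal (d\<^sup>2 * norm (g s))
      \<le> 4 * (\<integral>\<^sup>+w. ennreal (norm (g w)) * indicator (square s d) w \<partial>lborel)"
proof -
  define F where "F = (\<lambda>w. ennreal (norm (g w)) * indicator (square s d) w)"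
  have F[measurable]: "F \<in> borel_measurable borel"
    unfolding F_def using assms(1)
    by (intro measurable_norm_indicator) (auto simp: square_def holomorphic_on_imp_continuous_on)
  define A B where "A = (\<lambda>x. \<integral>\<^sup>+y. F (Complex x y) \<partial>lborel)" and "B = (\<lambda>y. \<integral>\<^sup>+x. F (Complex x y) \<partial>lborel)"
  have "(\<lambda>v :: real \<times> real. Complex (snd v) (fst v)) \<in> borel_measurable borel"
    by (intro borel_measurable_continuous_onI continuous_intros)
  hence "(\<lambda>v. F (Complex (fst v) (snd v))) \<in> borel_measurable (lborel \<Otimes>\<^sub>M lborel)"
       "(\<lambda>v. F (Complex (snd v) (fst v))) \<in> borel_measurable (lborel \<Otimes>\<^sub>M lborel)"
    using measurable_compose[OF measurable_Complex F]
    by (auto simp: lborel_prod intro: measurable_compose[OF _ F])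
  hence AB[measurable]: "A \<in> borel_measurable borel" "B \<in> borel_measurable borel"
    unfolding A_def B_def
    using lborel.borel_measurable_nn_integral[of "\<lambda>x y. F (Complex x y)" lborel]
      lborel.borel_measurable_nn_integral[of "\<lambda>y x. F (Complex x y)" lborel]
    by (simp_all add: case_prod_beta')
  have shift: "(\<integral>\<^sup>+r. H (c + r) \<partial>lborel) = (\<integral>\<^sup>+r. H r \<partial>lborel)"
              "(\<integral>\<^sup>+r. H (c - r) \<partial>lborel) = (\<integral>\<^sup>+r. H r \<partial>lborel)"
    if [measurable]: "H \<in> borel_measurable borel" for H and c :: real
    using nn_integral_real_affine[of H 1 c] nn_integral_real_affine[of H "-1" c] by simp_all
  have ptw: "ennreal (pi * d * norm (g s)) * indicator {d/2..d} r
      \<le> A (Re s - r) + A (Re s + r) + B (Im s - r) + B (Im s + r)" for r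
  proof (cases "r \<in> {d/2..d}")
    case True
    hence r: "0 < r" "r \<le> d" using assms(2) by auto
    have sub: "square s r \<subseteq> square s d" using r by (auto simp: in_square_iff)
    have "ennreal (pi * d * norm (g s)) \<le> ennreal (2 * pi * r * norm (g s))"
      using True by (intro ennreal_leI mult_right_mono) auto
    also have "\<dots> \<le> A (Re s - r) + A (Re s + r) + B (Im s - r) + B (Im s + r)"
      using sub unfolding A_def B_def F_def
      by (intro order.trans[OF Cauchy_square[OF holomorphic_on_subset[OF assms(1) sub] r(1)]]
          add_mono nn_integral_mono mult_left_mono) (auto simp: indicator_def)
    finally show ?thesis using True by simp
  qed simp
  have "ennreal (pi * d * norm (g s)) * ennreal (d / 2)
      = (\<integral>\<^sup>+r. ennreal (pi * d * norm (g s)) * indicator {d/2..d} r \<partial>lborel)"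
    using assms(2) by (simp add: nn_integral_cmult)
  also have "\<dots> \<le> (\<integral>\<^sup>+r. A (Re s - r) + A (Re s + r) + B (Im s - r) + B (Im s + r) \<partial>lborel)"
    by (intro nn_integral_mono ptw)
  also have "\<dots> = (\<integral>\<^sup>+r. A r \<partial>lborel) + (\<integral>\<^sup>+r. A r \<partial>lborel) + (\<integral>\<^sup>+r. B r \<partial>lborel) + (\<integral>\<^sup>+r. B r \<partial>lborel)"
    by (simp add: nn_integral_add shift)
  also have "\<dots> = (1 + 1 + 1 + 1) * (\<integral>\<^sup>+w. F w \<partial>lborel)"
    unfolding A_def B_def nn_integral_complex(1)[OF F, symmetric] nn_integral_complex(2)[OF F, symmetric]
    by (simp only: distrib_right mult_1)
  also have "(1 + 1 + 1 + 1 :: ennreal) = 4" by simp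
  finally have main: "ennreal (pi * d * norm (g s)) * ennreal (d / 2) \<le> 4 * (\<integral>\<^sup>+w. F w \<partial>lborel)" .
  \<comment> \<open>The constant \<open>8 / \<pi>\<close> is rounded up to \<open>4\<close>.\<close>
  have "d\<^sup>2 * norm (g s) * 1 \<le> d\<^sup>2 * norm (g s) * (pi / 2)"
    using pi_gt3 by (intro mult_left_mono) auto
  hence "ennreal (d\<^sup>2 * norm (g s)) \<le> ennreal (pi * d * norm (g s)) * ennreal (d / 2)"
    using assms(2) by (auto simp: power2_eq_square mult_ac intro!: ennreal_leI simp flip: ennreal_mult')
  from order.trans[OF this main] show ?thesis by (simp add: F_def)
qed

section \<open>Integrability of the symbol suffices for a well-defined transform\<close>

text \<open>Since \<open>|tz| \<le> |z| < 1\<close>, the geometric series of \<open>1 / (1 - tz)\<close> is dominated, in \<open>L\<^sup>1\<close>, by a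
  convergent multiple of \<open>\<Sum>n. |z|\<^sup>n\<close>. Termwise integration gives both convergence of the integral
  and the power series of \<open>I_op \<mu> f\<close>, whose coefficients are the moments of \<open>f \<mu>\<close>.\<close>

lemma I_well_defined_if_integrable:
  fixes f :: "complex \<Rightarrow> complex" and \<mu> :: "real measure"
  assumes sp: "space \<mu> = {0..<1}" and int: "integrable \<mu> (\<lambda>t. f (of_real t))"
    and m: "(\<lambda>t. t) \<in> borel_measurable \<mu>"
  shows "I_well_defined \<mu> f"
proof -
  have tz: "norm (of_real t * z) \<le> norm z" "norm (of_real t * z) < 1"
    if "t \<in> space \<mu>" "z \<in> unit_disc" for t z
  proof -
    show "norm (of_real t * z) \<le> norm z"
      using that sp by (auto simp: norm_mult mult_left_le_one_le)
    thus "norm (of_real t * z) < 1" using that by simp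
  qed
  have tm: "integrable \<mu> (\<lambda>t. f (of_real t) * (of_real t * z) ^ n)" if "z \<in> unit_disc" for z n
  proof (rule Bochner_Integration.integrable_bound[OF int])
    show "(\<lambda>t. f (of_real t) * (of_real t * z) ^ n) \<in> borel_measurable \<mu>"
      using borel_measurable_integrable[OF int] m by measurable
    show "AE t in \<mu>. norm (f (of_real t) * (of_real t * z) ^ n) \<le> norm (f (of_real t))"
    proof (intro AE_I2)
      fix t assume "t \<in> space \<mu>"
      hence "norm (of_real t * z) ^ n \<le> 1" using tz(2)[OF _ that] by (intro power_le_one) (auto simp: less_imp_le)
      thus "norm (f (of_real t) * (of_real t * z) ^ n) \<le> norm (f (of_real t))"
        by (simp only: norm_mult[of "f _"] norm_power mult_left_le norm_ge_zero)
    qed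
  qed
  have geom: "(\<lambda>n. f (of_real t) * (of_real t * z) ^ n) sums I_integrand f z t"
    if "t \<in> space \<mu>" "z \<in> unit_disc" for t z
    using sums_mult[OF geometric_sums[OF tz(2)[OF that]], of "f (of_real t)"]
    by (simp add: I_integrand_def)
  have *: "integrable \<mu> (I_integrand f z)
      \<and> (\<lambda>n. (\<integral>t. f (of_real t) * of_real t ^ n \<partial>\<mu>) * (z - 0) ^ n) sums I_op \<mu> f z"
    if z: "z \<in> unit_disc" for z
  proof -
    let ?F = "\<lambda>n t. f (of_real t) * (of_real t * z) ^ n"
    have bound: "(\<integral>t. norm (?F n t) \<partial>\<mu>) \<le> (\<integral>t. norm (f (of_real t)) \<partial>\<mu>) * norm z ^ n" for n
    proof -
      have "(\<integral>t. norm (?F n t) \<partial>\<mu>) \<le> (\<integral>t. norm (f (of_real t)) * norm z ^ n \<partial>\<mu>)"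
        using tz(1)[OF _ z]
        by (intro integral_mono integrable_norm tm z integrable_mult_left int)
           (simp only: norm_mult[of "f _"] norm_power mult_left_mono power_mono norm_ge_zero)
      thus ?thesis by simp
    qed
    have s1: "AE t in \<mu>. summable (\<lambda>n. norm (?F n t))"
      using tz(2)[OF _ z]
      by (intro AE_I2) (auto simp: norm_mult norm_power intro!: summable_mult summable_geometric)
    have s2: "summable (\<lambda>n. \<integral>t. norm (?F n t) \<partial>\<mu>)"
      using z bound
      by (intro summable_comparison_test'[OF summable_mult[OF summable_geometric[of "norm z"]]])
         (auto simp: integral_nonneg_AE)
    have eq: "(\<Sum>n. ?F n t) = I_integrand f z t" if "t \<in> space \<mu>" for t
      using geom[OF that z] by (simp add: sums_iff)
    have "integrable \<mu> (\<lambda>t. \<Sum>n. ?F n t)"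
      by (rule integrable_suminf[OF tm[OF z] s1 s2])
    hence "integrable \<mu> (I_integrand f z)"
      using eq by (simp cong: Bochner_Integration.integrable_cong)
    moreover have "(\<lambda>n. integral\<^sup>L \<mu> (?F n)) sums I_op \<mu> f z"
      using sums_integral[OF tm[OF z] s1 s2] eq
      by (simp add: I_op_def cong: Bochner_Integration.integral_cong)
    moreover have "integral\<^sup>L \<mu> (?F n) = (\<integral>t. f (of_real t) * of_real t ^ n \<partial>\<mu>) * z ^ n" for n
      by (simp add: power_mult_distrib flip: mult.assoc)
    ultimately show ?thesis by simp
  qed
  have "I_op \<mu> f analytic_on ball 0 1"
    by (rule power_series_analytic[OF conjunct2[OF *]])
  with * show ?thesis by (simp add: I_well_defined_def)
qed

section \<open>The Besov condition as an integral over the disc\<close>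

lemma ennpowr_less_top_iff: "ennpowr x a < top \<longleftrightarrow> x < top"
  by (auto simp: ennpowr_def top.not_eq_extremum)

definition besov_density :: "real \<Rightarrow> (complex \<Rightarrow> complex) \<Rightarrow> complex \<Rightarrow> real" where
  "besov_density p f z = (1 - (cmod z)\<^sup>2) powr (p - 2) * cmod (deriv f z) powr p"

text \<open>The outer powers and the term \<open>f 0\<close> of the norm do not affect finiteness.\<close>

lemma besov_space_iff:
  "f \<in> besov_space p \<longleftrightarrow> f holomorphic_on unit_disc \<and>
     (\<integral>\<^sup>+ z. ennreal (besov_density p f z) * indicator unit_disc z \<partial>lborel) < \<infinity>"
proof (cases "f holomorphic_on unit_disc")
  case True
  let ?W = "\<lambda>z. (1 - (cmod z)\<^sup>2) powr (p - 2) * cmod (deriv f z) powr p"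
  have "continuous_on unit_disc (deriv f)"
    using True by (intro holomorphic_on_imp_continuous_on holomorphic_deriv) auto
  hence "deriv f \<in> borel_measurable (restrict_space borel unit_disc)"
    by (rule borel_measurable_continuous_on_restrict)
  hence [measurable]: "deriv f \<in> borel_measurable (restrict_space lborel unit_disc)"
    by (simp add: measurable_def space_restrict_space sets_restrict_space)
  have [measurable]: "(\<lambda>z. z) \<in> borel_measurable (restrict_space lborel unit_disc)"
    by (rule measurable_restrict_space1) simp
  have m: "(\<lambda>z. ennreal (?W z)) \<in> borel_measurable (restrict_space lborel unit_disc)"
    by measurable
  have "(\<integral>\<^sup>+ z. ennreal (?W z) \<partial>disc_area)
      = ennreal (1 / pi) * (\<integral>\<^sup>+ z. ennreal (?W z) * indicator unit_disc z \<partial>lborel)"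
    unfolding disc_area_def using m
    by (simp add: nn_integral_scale_measure nn_integral_restrict_space)
  hence "(\<integral>\<^sup>+ z. ennreal (?W z) \<partial>disc_area) < \<infinity>
      \<longleftrightarrow> (\<integral>\<^sup>+ z. ennreal (?W z) * indicator unit_disc z \<partial>lborel) < \<infinity>"
    by (auto simp: ennreal_mult_less_top)
  thus ?thesis
    using True by (simp add: besov_space_def besov_norm_def besov_rho_def besov_density_def ennpowr_less_top_iff analytic_on_open)
qed (auto simp: besov_space_def analytic_on_open)

section \<open>Radial growth of Besov functions\<close>

lemma dyadic_index:
  fixes u :: real
  assumes "0 < u" "u \<le> 1"
  obtains N where "(1/2)^N/2 \<le> u" "u \<le> (1/2)^N"
proof -
  let ?P = "\<lambda>n. (1/2)^n/2 \<le> u"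
  obtain n where "(1/2::real)^n < u"
    using real_arch_pow_inv[of u "1/2"] assms by auto
  moreover have "(1/2::real)^n / 2 \<le> (1/2)^n" by simp
  ultimately have "?P n" by linarith
  hence P: "?P (LEAST n. ?P n)" by (rule LeastI)
  define N where "N = (LEAST n. ?P n)"
  have "u \<le> (1/2)^N"
  proof (cases N)
    case (Suc m)
    hence "\<not> ?P m" using not_less_Least[of m ?P] by (simp add: N_def)
    thus ?thesis by (simp add: Suc)
  qed (use assms in simp)
  with P show ?thesis by (intro that[of N]) (simp_all add: N_def)
qed

text \<open>The first term suffices for \<open>x \<le> A\<close>; for \<open>x > A\<close> the second one does, as \<open>x\<^sup>1\<^sup>-\<^sup>p \<le> A\<^sup>1\<^sup>-\<^sup>p\<close>.
  With a suitable choice of \<open>A\<close> this replaces Hoelder's inequality.\<close>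

lemma powr_le_weak_Young:
  fixes x A p :: real
  assumes "0 \<le> x" "0 < A" "1 \<le> p"
  shows "x \<le> A + x powr p * A powr (1 - p)"
proof (cases "x \<le> A")
  case False
  hence "x powr (1 - p) \<le> A powr (1 - p)"
    using assms by (intro powr_mono2') auto
  hence "x powr p * x powr (1 - p) \<le> x powr p * A powr (1 - p)"
    by (intro mult_left_mono) auto
  moreover have "x powr p * x powr (1 - p) = x"
    using False assms by (simp flip: powr_add)
  ultimately show ?thesis using assms by linarith
qed (simp add: add_increasing2)

text \<open>Covers both signs of the exponent at once, so that the comparison of the weight with a power of the
  side length need not distinguish \<open>p < 2\<close> from \<open>p \<ge> 2\<close>.\<close>

lemma powr_le_powr_abs:
  fixes x c a :: real
  assumes "1 \<le> c" "1 / c \<le> x" "x \<le> c"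
  shows "x powr a \<le> c powr \<bar>a\<bar>"
proof -
  have "0 < 1 / c" using assms by simp
  hence x: "0 < x" using assms(2) by linarith
  show ?thesis
  proof (cases "a \<ge> 0")
    case True
    thus ?thesis using assms x by (simp add: powr_mono2)
  next
    case False
    have "x powr a = (1 / x) powr (-a)" using x by (simp add: powr_divide powr_minus_divide)
    also have "1 / x \<le> c" using assms x by (simp add: field_simps)
    hence "(1 / x) powr (-a) \<le> c powr (-a)"
      using False x by (intro powr_mono2) auto
    finally show ?thesis using False by simp
  qed
qed

text \<open>The box contains every square of half side \<open>h / 4\<close> centred on the segment \<open>[1 - h, 1 - h / 2]\<close>,
  where \<open>h = 2\<^sup>-\<^sup>n\<close>, and still stays at a distance comparable to \<open>h\<close> from the unit circle.\<close>

definition whitney_box :: "nat \<Rightarrow> complex set" where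
  "whitney_box n = cbox (Complex (1 - 5/4 * (1/2)^n) (- ((1/2)^n) / 4)) (Complex (1 - (1/2)^n / 4) ((1/2)^n / 4))"

lemma whitney_box_depth:
  assumes "w \<in> whitney_box n"
  shows "3/8 * (1/2)^n \<le> 1 - (cmod w)\<^sup>2" "1 - (cmod w)\<^sup>2 \<le> 5/2 * (1/2)^n" "w \<in> unit_disc"
proof -
  define h :: real where "h = (1/2)^n"
  have h: "0 < h" "h \<le> 1" by (auto simp: h_def power_le_one)
  define x where "x = 1 - Re w"
  have x: "h / 4 \<le> x" "x \<le> 5/4 * h" and y: "\<bar>Im w\<bar> \<le> h / 4"
    using assms by (auto simp: whitney_box_def in_cbox_complex_iff h_def x_def)
  have e: "1 - (cmod w)\<^sup>2 = x * (2 - x) - (Im w)\<^sup>2"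
    unfolding cmod_power2 x_def by (simp add: power2_eq_square algebra_simps)
  have y2: "(Im w)\<^sup>2 \<le> (h/4)\<^sup>2" using y h by (simp only: abs_le_square_iff[symmetric])
  have "0 \<le> (x - h/4) * (2 - h/4 - x)" using x h by (intro mult_nonneg_nonneg) auto
  hence "h/4 * (2 - h/4) \<le> x * (2 - x)" by (simp add: algebra_simps)
  moreover have "h/4 * (2 - h/4) - (h/4)\<^sup>2 - 3/8 * h = h * (1 - h) / 8"
    by (simp add: algebra_simps power2_eq_square)
  moreover have "0 \<le> h * (1 - h) / 8" using h by auto
  ultimately show 1: "3/8 * (1/2)^n \<le> 1 - (cmod w)\<^sup>2" 
    unfolding e h_def[symmetric] using y2 by linarith
  have "x * (2 - x) \<le> 2 * x" using zero_le_square[of x] by (simp add: algebra_simps)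
  thus "1 - (cmod w)\<^sup>2 \<le> 5/2 * (1/2)^n"
    unfolding e h_def[symmetric] using x zero_le_power2[of "Im w"] by linarith
  have "(cmod w)\<^sup>2 < 1" using 1 h by (simp add: h_def[symmetric])
  thus "w \<in> unit_disc" using abs_square_less_1[of "cmod w"] by simp
qed

lemma emeasure_whitney_box:
  "emeasure lborel (whitney_box n) = ennreal (((1/2)^n)\<^sup>2 / 2)"
proof -
  have "emeasure lborel (whitney_box n) = ennreal ((1/2)^n * ((1/2)^n / 2))"
    unfolding whitney_box_def
    by (subst emeasure_lborel_cbox) (auto simp: Basis_complex_def intro!: arg_cong[where f = ennreal])
  thus ?thesis by (simp add: power2_eq_square)
qed

text \<open>By \<open>whitney_box_depth\<close>, a point in boxes \<open>k\<close> and \<open>m\<close> has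
  \<open>2\<^sup>m \<le> (20/3) 2\<^sup>k < 2\<^sup>k\<^sup>+\<^sup>3\<close>, so the indices of the boxes around a point lie in a range of length three.\<close>

lemma sum_indicator_whitney_box_le:
  "(\<Sum>n\<le>N. indicator (whitney_box n) w :: ennreal) \<le> 3"
proof -
  define S where "S = {n\<in>{..N}. w \<in> whitney_box n}"
  have "card S \<le> 3"
  proof (cases "S = {}")
    case False
    have fin: "finite S" by (simp add: S_def)
    define k where "k = Min S"
    have k: "k \<in> S" "\<And>m. m \<in> S \<Longrightarrow> k \<le> m" using False fin by (auto simp: k_def)
    have "m < k + 3" if "m \<in> S" for m
    proof -
      have "3/8 * (1/2)^k \<le> (5/2 * (1/2)^m :: real)"
        using whitney_box_depth(1)[of w k] whitney_box_depth(2)[of w m] k(1) that by (auto simp: S_def)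
      hence "3 * (2::real)^m \<le> 20 * 2^k"
        by (simp add: power_one_over field_simps)
      hence "(2::real)^m < 8 * 2^k"
        using zero_less_power[of "2::real" k] by linarith
      hence "(2::real)^m < 2^(k+3)"
        by (simp add: power_add)
      thus ?thesis by simp
    qed
    hence "S \<subseteq> {k..<k+3}" using k by auto
    from card_mono[OF _ this] show ?thesis by simp
  qed simp
  moreover have "(\<Sum>n\<le>N. indicator (whitney_box n) w :: ennreal) = of_nat (card S)"
    by (simp add: S_def indicator_def sum.If_cases Int_def flip: sum.inter_filter)
  ultimately show ?thesis
    using of_nat_mono[of "card S" 3, where 'a = ennreal] by simp
qed

definition whitney_mass :: "real \<Rightarrow> (complex \<Rightarrow> complex) \<Rightarrow> nat \<Rightarrow> ennreal" where
  "whitney_mass p f n = (\<integral>\<^sup>+z. ennreal (besov_density p f z) * indicator (whitney_box n) z \<partial>lborel)"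

context
  fixes p :: real and f :: "complex \<Rightarrow> complex"
  assumes p: "1 < p" and hol: "f holomorphic_on unit_disc"
begin

lemma measurable_besov_density:
  assumes "A \<in> sets borel" "A \<subseteq> unit_disc"
  shows "(\<lambda>z. ennreal (besov_density p f z) * indicator A z) \<in> borel_measurable borel"
proof -
  have "continuous_on A (deriv f)"
    using hol assms(2)
    by (intro continuous_on_subset[OF holomorphic_on_imp_continuous_on[OF holomorphic_deriv[OF hol]]]) auto
  hence [measurable]: "(\<lambda>z. indicator A z *\<^sub>R deriv f z) \<in> borel_measurable borel"
    using assms(1) by (intro borel_measurable_continuous_on_indicator)
  have [measurable]: "A \<in> sets borel" by fact
  have "(\<lambda>z. ennreal ((1 - (cmod z)\<^sup>2) powr (p - 2) * cmod (indicator A z *\<^sub>R deriv f z) powr p)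
      * indicator A z) \<in> borel_measurable borel"
    by measurable
  also have "(\<lambda>z. ennreal ((1 - (cmod z)\<^sup>2) powr (p - 2) * cmod (indicator A z *\<^sub>R deriv f z) powr p)
      * indicator A z) = (\<lambda>z. ennreal (besov_density p f z) * indicator A z)"
    by (auto simp: besov_density_def indicator_def)
  finally show ?thesis .
qed

text \<open>The free parameter \<open>M\<close> comes from \<open>powr_le_weak_Young\<close>, applied with \<open>A = M / h\<close>, \<open>h = 2\<^sup>-\<^sup>n\<close>. With
  this scaling all powers of \<open>h\<close> cancel, so the bound has the same form for every \<open>n\<close> and
  \<open>M\<close> can be chosen after summation.\<close>

lemma oscillation_le_whitney_mass:
  assumes M: "0 < M" and ab: "a \<in> {1 - (1/2)^n..1 - (1/2)^n/2}" "b \<in> {1 - (1/2)^n..1 - (1/2)^n/2}"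
  shows "ennreal (norm (f (of_real a) - f (of_real b)))
     \<le> ennreal (16 * M) + ennreal (32 * M powr (1 - p) * (8/3) powr \<bar>p - 2\<bar>) * whitney_mass p f n"
    (is "_ \<le> ?R")
proof (cases "?R = \<infinity>")
  case False
  define h :: real where "h = (1/2)^n"
  have h: "0 < h" "h \<le> 1" by (auto simp: h_def power_le_one)
  define K where "K = (8/3 :: real) powr \<bar>p - 2\<bar>"
  let ?Q = "whitney_box n"
  let ?g = "deriv f"
  have Q: "?Q \<subseteq> unit_disc" using whitney_box_depth(3) by blast
  have Qm[measurable]: "?Q \<in> sets borel" by (simp add: whitney_box_def)
  have gm[measurable]: "(\<lambda>w. ennreal (norm (?g w)) * indicator ?Q w) \<in> borel_measurable borel"
    using Q by (intro measurable_norm_indicator Qm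
       continuous_on_subset[OF holomorphic_on_imp_continuous_on[OF holomorphic_deriv[OF hol]]]) auto
  have dm[measurable]: "(\<lambda>w. ennreal (besov_density p f w) * indicator ?Q w) \<in> borel_measurable borel"
    using Q by (intro measurable_besov_density) auto
  define c where "c = (M / h) powr (1 - p) * (K * h powr (2 - p))"
  have ptw: "norm (?g w) \<le> M / h + c * besov_density p f w" if "w \<in> ?Q" for w
  proof -
    define u where "u = 1 - (cmod w)\<^sup>2"
    have u: "3/8 * h \<le> u" "u \<le> 5/2 * h" using whitney_box_depth[OF that] by (simp_all add: u_def h_def)
    hence u0: "0 < u" using h by linarith
    \<comment> \<open>The weight is constant on the box up to the factor \<open>K\<close>, whatever the sign of \<open>p - 2\<close>.\<close>
    have "(h / u) powr (p - 2) \<le> K"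
      unfolding K_def using u u0 h by (intro powr_le_powr_abs) (auto simp: field_simps)
    hence "1 \<le> K * h powr (2 - p) * u powr (p - 2)"
      using h u0 by (simp add: powr_divide field_simps powr_diff)
    hence "1 * cmod (?g w) powr p \<le> K * h powr (2 - p) * u powr (p - 2) * cmod (?g w) powr p"
      by (rule mult_right_mono) simp
    hence "cmod (?g w) powr p \<le> K * h powr (2 - p) * besov_density p f w"
      by (simp add: besov_density_def u_def mult_ac)
    hence "cmod (?g w) powr p * (M / h) powr (1 - p)
        \<le> K * h powr (2 - p) * besov_density p f w * (M / h) powr (1 - p)"
      by (rule mult_right_mono) simp
    hence "cmod (?g w) powr p * (M / h) powr (1 - p) \<le> c * besov_density p f w"
      by (simp add: c_def mult_ac)
    moreover have "norm (?g w) \<le> M / h + cmod (?g w) powr p * (M / h) powr (1 - p)"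
      using M h p by (intro powr_le_weak_Young) auto
    ultimately show ?thesis by linarith
  qed
  have c0: "0 \<le> c" by (auto simp: c_def K_def)
  have d0: "0 \<le> besov_density p f w" for w by (simp add: besov_density_def)
  have "(\<integral>\<^sup>+w. ennreal (norm (?g w)) * indicator ?Q w \<partial>lborel)
      \<le> (\<integral>\<^sup>+w. ennreal (M / h) * indicator ?Q w + ennreal c * (ennreal (besov_density p f w) * indicator ?Q w) \<partial>lborel)"
  proof (intro nn_integral_mono)
    fix w
    have "ennreal (norm (?g w)) \<le> ennreal (M / h) + ennreal c * ennreal (besov_density p f w)" if "w \<in> ?Q"
      using ptw[OF that] c0 d0 M h by (simp add: ennreal_leI flip: ennreal_mult ennreal_plus)
    thus "ennreal (norm (?g w)) * indicator ?Q w
      \<le> ennreal (M / h) * indicator ?Q w + ennreal c * (ennreal (besov_density p f w) * indicator ?Q w)"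
      by (auto simp: indicator_def)
  qed
  also have "\<dots> = ennreal (M / h) * ennreal (h\<^sup>2 / 2) + ennreal c * whitney_mass p f n"
    by (simp add: nn_integral_add nn_integral_cmult emeasure_whitney_box whitney_mass_def flip: h_def)
  finally have mass: "(\<integral>\<^sup>+w. ennreal (norm (?g w)) * indicator ?Q w \<partial>lborel) \<le> \<dots>" .
  have R: "ennreal (32 / h) * (ennreal (M / h) * ennreal (h\<^sup>2 / 2) + ennreal c * whitney_mass p f n) = ?R"
  proof -
    have "32 / h * (M / h * (h\<^sup>2 / 2)) = 16 * M"
      using h by (simp add: field_simps power2_eq_square)
    moreover have "32 / h * c = 32 * M powr (1 - p) * K"
    proof -
      have "h powr (2 - p) = h * h powr (1 - p)"
        using h powr_add[of h 1 "1 - p"] by simp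
      thus ?thesis using h M by (simp add: c_def powr_divide)
    qed
    ultimately show ?thesis
      using c0 h M by (simp add: distrib_left mult.assoc[symmetric] K_def flip: ennreal_mult)
  qed
  have sup: "ennreal (norm (?g (of_real s)) * (h / 2)) \<le> ?R" if s: "s \<in> {1 - h..1 - h/2}" for s
  proof -
    have sub: "square (of_real s) (h / 4) \<subseteq> ?Q"
    proof
      fix x assume "x \<in> square (of_real s) (h / 4)"
      hence "\<bar>Re x - s\<bar> \<le> h / 4" "\<bar>Im x\<bar> \<le> h / 4" by (simp_all only: in_square_iff) simp_all
      moreover have "1 - h \<le> s" "s \<le> 1 - h / 2" using s by auto
      ultimately show "x \<in> ?Q"
        unfolding whitney_box_def in_cbox_complex_iff complex.sel h_def[symmetric] atLeastAtMost_iff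
        by (intro conjI; linarith)
    qed
    have "norm (?g (of_real s)) * (h / 2) = 8 / h * ((h / 4)\<^sup>2 * norm (?g (of_real s)))"
      using h by (simp add: field_simps power2_eq_square)
    hence "ennreal (norm (?g (of_real s)) * (h / 2))
        = ennreal (8 / h) * ennreal ((h / 4)\<^sup>2 * norm (?g (of_real s)))"
      using h by (simp only:) (rule ennreal_mult, auto)
    also have "\<dots> \<le> ennreal (8 / h) * (4 * (\<integral>\<^sup>+w. ennreal (norm (?g w)) * indicator (square (of_real s) (h / 4)) w \<partial>lborel))"
      using h sub Q by (intro mult_left_mono area_mean_value_square
         holomorphic_on_subset[OF holomorphic_deriv[OF hol]]) auto
    also have "\<dots> \<le> ennreal (8 / h) * (4 * (\<integral>\<^sup>+w. ennreal (norm (?g w)) * indicator ?Q w \<partial>lborel))"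
      using sub by (intro mult_left_mono nn_integral_mono) (auto simp: indicator_def)
    also have "\<dots> = ennreal (32 / h) * (\<integral>\<^sup>+w. ennreal (norm (?g w)) * indicator ?Q w \<partial>lborel)"
      using h by (simp add: mult.assoc[symmetric] ennreal_mult[symmetric] flip: ennreal_numeral)
    also have "\<dots> \<le> ?R"
      unfolding R[symmetric] by (intro mult_left_mono mass) simp
    finally show ?thesis .
  qed
  \<comment> \<open>The right-hand side is a real number, so it bounds the derivative on the segment.\<close>
  obtain r where r: "?R = ennreal r" "0 \<le> r"
    using False by (cases ?R) auto
  let ?S = "closed_segment (of_real (1 - h)) (of_real (1 - h/2)) :: complex set"
  have S: "?S = of_real ` {1 - h..1 - h/2}"
    unfolding closed_segment_of_real using h by (simp add: closed_segment_eq_real_ivl)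
  have "norm (f (of_real a) - f (of_real b)) \<le> (2 * r / h) * norm (of_real a - of_real b :: complex)"
  proof (rule field_differentiable_bound[of ?S f ?g])
    fix z assume "z \<in> ?S"
    then obtain s where s: "z = of_real s" "s \<in> {1 - h..1 - h/2}" using S by auto
    have "z \<in> unit_disc" using s h by auto
    thus "(f has_field_derivative ?g z) (at z within ?S)"
      by (rule holomorphic_derivI[OF hol open_ball])
    have "norm (?g z) * (h / 2) \<le> r" using sup[OF s(2)] r s(1) by simp
    thus "norm (?g z) \<le> 2 * r / h" using h by (simp add: field_simps)
  next
    show "convex ?S" by (rule convex_closed_segment)
    show "of_real a \<in> ?S" "of_real b \<in> ?S"
      unfolding S unfolding h_def using ab by auto
  qed
  also have "norm (of_real a - of_real b :: complex) \<le> h / 2"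
  proof -
    have "\<bar>a - b\<bar> \<le> h / 2" using ab unfolding h_def[symmetric] atLeastAtMost_iff by linarith
    thus ?thesis by (simp only: norm_of_real of_real_diff[symmetric])
  qed
  hence "(2 * r / h) * norm (of_real a - of_real b :: complex) \<le> (2 * r / h) * (h / 2)"
    using r h by (intro mult_left_mono) auto
  also have "\<dots> = r" using h by simp
  finally show ?thesis by (simp add: r ennreal_leI)
qed simp

lemma sum_whitney_mass_le:
  "(\<Sum>n\<le>N. whitney_mass p f n) \<le> 3 * (\<integral>\<^sup>+z. ennreal (besov_density p f z) * indicator unit_disc z \<partial>lborel)"
proof -
  have [measurable]: "(\<lambda>z. ennreal (besov_density p f z) * indicator (whitney_box n) z) \<in> borel_measurable borel" for n
    using whitney_box_depth(3) by (intro measurable_besov_density) (auto simp: whitney_box_def)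
  have [measurable]: "(\<lambda>z. ennreal (besov_density p f z) * indicator unit_disc z) \<in> borel_measurable borel"
    by (intro measurable_besov_density) auto
  have "(\<Sum>n\<le>N. whitney_mass p f n)
     = (\<integral>\<^sup>+z. (\<Sum>n\<le>N. ennreal (besov_density p f z) * indicator (whitney_box n) z) \<partial>lborel)"
    unfolding whitney_mass_def by (subst nn_integral_sum) auto
  also have "\<dots> \<le> (\<integral>\<^sup>+z. 3 * (ennreal (besov_density p f z) * indicator unit_disc z) \<partial>lborel)"
  proof (intro nn_integral_mono)
    fix z
    show "(\<Sum>n\<le>N. ennreal (besov_density p f z) * indicator (whitney_box n) z)
      \<le> 3 * (ennreal (besov_density p f z) * indicator unit_disc z)"
    proof (cases "z \<in> unit_disc")
      case True
      have "(\<Sum>n\<le>N. ennreal (besov_density p f z) * indicator (whitney_box n) z)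
          = ennreal (besov_density p f z) * (\<Sum>n\<le>N. indicator (whitney_box n) z)"
        by (simp add: sum_distrib_left)
      also have "\<dots> \<le> ennreal (besov_density p f z) * 3"
        by (intro mult_left_mono sum_indicator_whitney_box_le) simp
      finally show ?thesis using True by (simp add: mult.commute)
    next
      case False
      hence "indicator (whitney_box n) z = (0::ennreal)" for n
        using whitney_box_depth(3)[of z n] by (auto simp: indicator_def)
      thus ?thesis by simp
    qed
  qed
  also have "\<dots> = 3 * (\<integral>\<^sup>+z. ennreal (besov_density p f z) * indicator unit_disc z \<partial>lborel)"
    by (rule nn_integral_cmult) measurable
  finally show ?thesis .
qed

lemma dyadic_chain:
  assumes M: "0 < M" and t: "t \<in> {1 - (1/2)^N..1 - (1/2)^N/2}"
  shows "ennreal (norm (f (of_real t) - f 0))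
     \<le> (\<Sum>n\<le>N. ennreal (16 * M) + ennreal (32 * M powr (1 - p) * (8/3) powr \<bar>p - 2\<bar>) * whitney_mass p f n)"
  using t
proof (induction N arbitrary: t)
  case 0
  thus ?case using oscillation_le_whitney_mass[OF M, of t 0 0] by simp
next
  case (Suc N)
  define s :: real where "s = 1 - (1/2)^Suc N"
  let ?e = "\<lambda>n. ennreal (16 * M) + ennreal (32 * M powr (1 - p) * (8/3) powr \<bar>p - 2\<bar>) * whitney_mass p f n"
  have "ennreal (norm (f (of_real t) - f 0))
     \<le> ennreal (norm (f (of_real s) - f 0) + norm (f (of_real t) - f (of_real s)))"
    using norm_triangle_ineq[of "f (of_real s) - f 0" "f (of_real t) - f (of_real s)"]
    by (intro ennreal_leI) simp
  also have "\<dots> = ennreal (norm (f (of_real s) - f 0)) + ennreal (norm (f (of_real t) - f (of_real s)))"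
    by simp
  also have "\<dots> \<le> (\<Sum>n\<le>N. ?e n) + ?e (Suc N)"
  proof (rule add_mono)
    show "ennreal (norm (f (of_real s) - f 0)) \<le> (\<Sum>n\<le>N. ?e n)"
      by (rule Suc.IH) (simp add: s_def)
    show "ennreal (norm (f (of_real t) - f (of_real s))) \<le> ?e (Suc N)"
      using Suc.prems by (intro oscillation_le_whitney_mass[OF M]) (auto simp: s_def)
  qed
  finally show ?case by simp
qed

end

text \<open>With \<open>X = N + 1\<close> the chained oscillations give \<open>O(M X + M\<^sup>1\<^sup>-\<^sup>p)\<close>; the choice
  \<open>M = X\<^sup>-\<^sup>1\<^sup>/\<^sup>p\<close> makes both terms equal to \<open>X\<^sup>1\<^sup>-\<^sup>1\<^sup>/\<^sup>p\<close>.\<close>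

lemma besov_growth:
  assumes p: "1 < p" and f: "f \<in> besov_space p"
  obtains C where "0 \<le> C"
    "\<And>t. 0 \<le> t \<Longrightarrow> t < 1 \<Longrightarrow> norm (f (of_real t)) \<le> C * ln (2 / (1 - t)) powr (1 - 1 / p)"
proof -
  have hol: "f holomorphic_on unit_disc" using f by (simp add: besov_space_iff)
  let ?J = "\<integral>\<^sup>+z. ennreal (besov_density p f z) * indicator unit_disc z \<partial>lborel"
  have "?J < \<infinity>" using f by (simp add: besov_space_iff)
  then obtain j where j: "?J = ennreal j" "0 \<le> j" by (cases ?J) auto
  define q where "q = 1 - 1 / p"
  have q: "0 < q" using p by (simp add: q_def)
  define K where "K = (8/3 :: real) powr \<bar>p - 2\<bar>"
  define C where "C = norm (f 0) + 16 + 96 * K * j"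
  have C: "0 \<le> C" using j by (simp add: C_def K_def)
  have "norm (f (of_real t)) \<le> (C * 2 powr q) * ln (2 / (1 - t)) powr q" if t: "0 \<le> t" "t < 1" for t
  proof -
    obtain N where N: "t \<in> {1 - (1/2)^N..1 - (1/2)^N/2}" 
      using dyadic_index[of "1 - t"] t by (auto simp: algebra_simps)
    define X where "X = real N + 1"
    \<comment> \<open>This value balances \<open>M X\<close> against \<open>M\<^sup>1\<^sup>-\<^sup>p\<close>.\<close>
    define M where "M = X powr (- 1 / p)"
    have X: "1 \<le> X" by (simp add: X_def)
    have M: "0 < M" using X by (simp add: M_def)
    have MX: "M * X = X powr q"
      using X powr_add[of X "- 1 / p" 1] by (simp add: M_def q_def)
    have Mp: "M powr (1 - p) = X powr q"
    proof -
      have "- 1 / p * (1 - p) = q" using p by (simp add: q_def field_simps)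
      thus ?thesis by (simp only: M_def powr_powr)
    qed
    have "ennreal (norm (f (of_real t) - f 0))
        \<le> (\<Sum>n\<le>N. ennreal (16 * M) + ennreal (32 * M powr (1 - p) * K) * whitney_mass p f n)"
      using dyadic_chain[OF p hol M N] by (simp add: K_def)
    also have "\<dots> = ennreal (16 * M * X) + ennreal (32 * M powr (1 - p) * K) * (\<Sum>n\<le>N. whitney_mass p f n)"
    proof -
      have "(\<Sum>n\<le>N. ennreal (16 * M)) = ennreal (\<Sum>n\<le>N. 16 * M)"
        using M by (subst sum_ennreal) auto
      also have "(\<Sum>n\<le>N. 16 * M) = 16 * M * X" by (simp add: X_def algebra_simps)
      finally show ?thesis by (simp only: sum.distrib sum_distrib_left)
    qed
    also have "\<dots> \<le> ennreal (16 * M * X) + ennreal (32 * M powr (1 - p) * K) * (3 * ennreal j)"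
      using sum_whitney_mass_le[OF p hol, of N] j by (intro add_mono mult_left_mono) auto
    also have "\<dots> = ennreal (16 * M * X + 32 * M powr (1 - p) * K * (3 * j))"
    proof -
      have "3 * ennreal j = ennreal (3 * j)" using j by (simp add: ennreal_mult')
      thus ?thesis using M X j
        by (simp only: ennreal_mult''[symmetric] mult_nonneg_nonneg zero_le_numeral)
           (subst ennreal_plus, auto simp: K_def)
    qed
    finally have "norm (f (of_real t) - f 0) \<le> 16 * M * X + 32 * M powr (1 - p) * K * (3 * j)"
      using M X j by (subst (asm) ennreal_le_iff) (auto simp: K_def)
    also have "\<dots> = (16 + 96 * K * j) * X powr q"
      using MX Mp by (simp add: algebra_simps)
    finally have "norm (f (of_real t)) \<le> norm (f 0) * 1 + (16 + 96 * K * j) * X powr q"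
      using norm_triangle_sub[of "f (of_real t)" "f 0"] by linarith
    also have "\<dots> \<le> norm (f 0) * X powr q + (16 + 96 * K * j) * X powr q"
      using X q j by (intro add_mono mult_left_mono ge_one_powr_ge_zero) (auto simp: K_def)
    also have "\<dots> = C * X powr q" by (simp add: C_def algebra_simps)
    also have "X \<le> 2 * ln (2 / (1 - t))"
    proof -
      have "X * ln 2 = ln (2 ^ Suc N)"
        by (simp only: ln_realpow) (simp add: X_def algebra_simps)
      also have "\<dots> \<le> ln (2 / (1 - t))"
        using N t by (subst ln_le_cancel_iff) (auto simp: field_simps power_one_over)
      finally have "X * ln 2 \<le> ln (2 / (1 - t))" .
      moreover have "X * (1/2) \<le> X * ln 2" using ln2_ge_two_thirds X by (intro mult_left_mono) auto
      ultimately show ?thesis by linarith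
    qed
    hence "C * X powr q \<le> C * (2 * ln (2 / (1 - t))) powr q"
      using C X q by (intro mult_left_mono powr_mono2) auto
    also have "\<dots> = C * 2 powr q * ln (2 / (1 - t)) powr q"
      using t by (simp add: powr_mult)
    finally show ?thesis .
  qed
  with C show ?thesis by (intro that[of "C * 2 powr q"]) (auto simp: q_def)
qed

section \<open>Powers of the logarithm as Besov functions\<close>

lemma nn_integral_powr_from_0:
  fixes a r :: real
  assumes "a > -1" "0 \<le> r"
  shows "(\<integral>\<^sup>+u. ennreal (u powr a) * indicator {0..r} u \<partial>lborel) = ennreal (r powr (a + 1) / (a + 1))"
  using assms by (intro nn_integral_has_integral_lebesgue' has_integral_powr_from_0) auto

text \<open>The half lines \<open>x \<ge> 0\<close> and \<open>x \<le> 0\<close> contribute at most one full integral of \<open>G\<close> each.\<close>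

lemma nn_integral_reflect_abs_le:
  fixes G :: "real \<Rightarrow> ennreal"
  assumes [measurable]: "G \<in> borel_measurable borel"
  shows "(\<integral>\<^sup>+x. G (c - \<bar>x\<bar>) \<partial>lborel) \<le> 2 * (\<integral>\<^sup>+u. G u \<partial>lborel)"
proof -
  have "(\<integral>\<^sup>+x. G (c - \<bar>x\<bar>) \<partial>lborel) \<le> (\<integral>\<^sup>+x. G (c - x) + G (c + x) \<partial>lborel)"
    by (intro nn_integral_mono) (auto simp: abs_if add_increasing add_increasing2)
  also have "\<dots> = (\<integral>\<^sup>+x. G (c - x) \<partial>lborel) + (\<integral>\<^sup>+x. G (c + x) \<partial>lborel)"
    by (rule nn_integral_add) measurable
  also have "\<dots> = 2 * (\<integral>\<^sup>+u. G u \<partial>lborel)"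
    using nn_integral_real_affine[of G 1 c] nn_integral_real_affine[of G "-1" c]
    by (simp add: mult_2)
  finally show ?thesis .
qed

definition disc_weight :: "real \<Rightarrow> complex \<Rightarrow> real" where
  "disc_weight p z = (1 - (cmod z)\<^sup>2) powr (p - 2)"

lemma measurable_disc_weight:
  assumes "A \<in> sets borel" "A \<subseteq> unit_disc"
  shows "(\<lambda>z. ennreal (disc_weight p z) * indicator A z) \<in> borel_measurable borel"
proof -
  have "continuous_on A (\<lambda>z. complex_of_real (disc_weight p z))"
    unfolding disc_weight_def using assms(2)
    by (intro continuous_intros) (auto simp: abs_square_eq_1)
  from measurable_norm_indicator[OF this assms(1)] show ?thesis
    by (simp add: disc_weight_def)
qed

lemma disc_weight_near_1:
  assumes "z \<in> unit_disc" "cmod (1 - z) < r" "2 \<le> p"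
  shows "disc_weight p z \<le> (2 * r) powr (p - 2)"
proof -
  have "1 - cmod z \<le> cmod (1 - z)" using norm_triangle_ineq2[of 1 z] by simp
  hence "(1 - cmod z) * (1 + cmod z) \<le> r * 2"
    using assms by (intro mult_mono) auto
  moreover have "0 \<le> (1 - cmod z) * (1 + cmod z)"
    using assms by (intro mult_nonneg_nonneg) auto
  ultimately show ?thesis
    unfolding disc_weight_def using assms(3)
    by (intro powr_mono2) (auto simp: power2_eq_square algebra_simps)
qed

lemma disc_mass_near_1_large_p:
  assumes "2 \<le> p" "0 < r"
  shows "(\<integral>\<^sup>+z. ennreal (disc_weight p z) * indicator (unit_disc \<inter> ball 1 r) z \<partial>lborel)
      \<le> ennreal (2 powr p * r powr p)"
proof -
  have "(\<integral>\<^sup>+z. ennreal (disc_weight p z) * indicator (unit_disc \<inter> ball 1 r) z \<partial>lborel)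
     \<le> (\<integral>\<^sup>+z. ennreal ((2 * r) powr (p - 2)) * indicator (square 1 r) z \<partial>lborel)"
  proof (intro nn_integral_mono)
    fix z
    show "ennreal (disc_weight p z) * indicator (unit_disc \<inter> ball 1 r) z
        \<le> ennreal ((2 * r) powr (p - 2)) * indicator (square 1 r) z"
    proof (cases "z \<in> unit_disc \<inter> ball 1 r")
      case True
      hence *: "z \<in> unit_disc" "cmod (1 - z) < r" by (auto simp: dist_norm)
      have "z \<in> square 1 r"
        using *(2) abs_Re_le_cmod[of "1 - z"] abs_Im_le_cmod[of "1 - z"] by (auto simp: in_square_iff)
      thus ?thesis using disc_weight_near_1[OF * assms(1)] True by (simp add: ennreal_leI)
    qed simp
  qed
  also have "\<dots> = ennreal ((2 * r) powr (p - 2)) * emeasure lborel (square 1 r)"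
    by (rule nn_integral_cmult_indicator) (simp add: square_def)
  also have "emeasure lborel (square 1 r) = ennreal ((2 * r) powr 2)"
    unfolding square_def using assms(2)
    by (subst emeasure_lborel_cbox) (auto simp: Basis_complex_def power2_eq_square)
  also have "ennreal ((2 * r) powr (p - 2)) * ennreal ((2 * r) powr 2) = ennreal (2 powr p * r powr p)"
  proof -
    have "(2 * r) powr (p - 2) * (2 * r) powr 2 = (2 * r) powr (p - 2 + 2)" 
      by (simp only: powr_add)
    also have "\<dots> = 2 powr p * r powr p" using assms by (simp add: powr_mult)
    finally show ?thesis by (simp only: ennreal_mult[symmetric] powr_ge_zero)
  qed
  finally show ?thesis .
qed

text \<open>For \<open>p < 2\<close> the weight is singular on the whole circle. On the horizontal line at height \<open>y\<close>, with
  \<open>c = sqrt (1 - y\<^sup>2)\<close>, it is \<open>((c - |x|) (c + |x|))\<^sup>p\<^sup>-\<^sup>2 \<le> (c - |x|)\<^sup>p\<^sup>-\<^sup>2 c\<^sup>p\<^sup>-\<^sup>2\<close>. At points of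
  the disc within distance \<open>r\<close> of \<open>1\<close> one has \<open>0 < c - |x| \<le> r\<close>, so the first factor integrates to
  \<open>O(r\<^sup>p\<^sup>-\<^sup>1)\<close>. The second is at most \<open>(1 - |y|)\<^sup>-\<^sup>1\<^sup>/\<^sup>2\<close>, which integrates to \<open>O(r)\<close> over
  \<open>|y| \<le> min r 1\<close>, uniformly in \<open>r\<close>.\<close>

lemma disc_mass_near_1_small_p:
  assumes p: "1 < p" "p < 2" and r: "0 < r"
  shows "(\<integral>\<^sup>+z. ennreal (disc_weight p z) * indicator (unit_disc \<inter> ball 1 r) z \<partial>lborel)
      \<le> ennreal (8 / (p - 1) * r powr p)"
proof -
  define G where "G = (\<lambda>u. ennreal (u powr (p - 2)) * indicator {0..r} u)"
  define H where "H = (\<lambda>v. ennreal (v powr (-1/2)) * indicator {1 - min r 1..1} v)"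
  have [measurable]: "G \<in> borel_measurable borel" "H \<in> borel_measurable borel"
    by (simp_all add: G_def H_def)
  define c where "c = (\<lambda>y::real. sqrt (1 - y\<^sup>2))"
  have ptw: "ennreal (disc_weight p (Complex x y)) * indicator (unit_disc \<inter> ball 1 r) (Complex x y)
      \<le> H (1 - \<bar>y\<bar>) * G (c y - \<bar>x\<bar>)" for x y
  proof (cases "Complex x y \<in> unit_disc \<inter> ball 1 r")
    case True
    have n: "x\<^sup>2 + y\<^sup>2 < 1" and d: "cmod (1 - Complex x y) < r"
      using True by (auto simp: dist_norm cmod_def real_sqrt_lt_1_iff)
    have dx: "\<bar>1 - x\<bar> < r" and dy: "\<bar>y\<bar> < r"
      using d abs_Re_le_cmod[of "1 - Complex x y"] abs_Im_le_cmod[of "1 - Complex x y"] by auto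
    have y1: "y\<^sup>2 < 1" using n zero_le_power2[of x] by linarith
    hence y: "\<bar>y\<bar> < 1" by (simp add: abs_square_less_1)
    have c: "0 < c y" "c y \<le> 1" "(c y)\<^sup>2 = 1 - y\<^sup>2" using y1 by (auto simp: c_def)
    have "x\<^sup>2 < (c y)\<^sup>2" using n c by simp
    hence x: "\<bar>x\<bar> < c y" using c(1) by (intro power2_less_imp_less[of "\<bar>x\<bar>"]) auto
    have u: "0 < c y - \<bar>x\<bar>" "c y - \<bar>x\<bar> \<le> r" using x c dx by auto
    have "disc_weight p (Complex x y) = ((c y - \<bar>x\<bar>) * (c y + \<bar>x\<bar>)) powr (p - 2)"
    proof -
      have "(c y - \<bar>x\<bar>) * (c y + \<bar>x\<bar>) = (c y)\<^sup>2 - x\<^sup>2" 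
        by (simp add: algebra_simps power2_eq_square)
      thus ?thesis by (simp add: disc_weight_def cmod_power2 c diff_diff_add add.commute)
    qed
    also have "\<dots> = (c y - \<bar>x\<bar>) powr (p - 2) * (c y + \<bar>x\<bar>) powr (p - 2)"
      using u by (simp add: powr_mult)
    also have "(c y + \<bar>x\<bar>) powr (p - 2) \<le> c y powr (p - 2)"
      using c p by (intro powr_mono2') auto
    also have "c y powr (p - 2) = (1 - y\<^sup>2) powr ((p - 2) / 2)"
      using y1 by (simp add: c_def powr_half_sqrt[symmetric] powr_powr)
    also have "\<dots> \<le> (1 - \<bar>y\<bar>) powr ((p - 2) / 2)"
    proof (intro powr_mono2')
      show "1 - \<bar>y\<bar> \<le> 1 - y\<^sup>2" using y mult_left_le[of "\<bar>y\<bar>" "\<bar>y\<bar>"] by (simp add: power2_eq_square)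
    qed (use y p in auto)
    also have "\<dots> \<le> (1 - \<bar>y\<bar>) powr (-1/2)"
      using y p by (intro powr_mono') auto
    finally have "disc_weight p (Complex x y) \<le> (c y - \<bar>x\<bar>) powr (p - 2) * (1 - \<bar>y\<bar>) powr (-1/2)"
      by (simp add: mult_left_mono)
    thus ?thesis
      using True u y dy by (simp add: G_def H_def mult.commute ennreal_leI flip: ennreal_mult')
  qed simp
  have Gint: "(\<integral>\<^sup>+u. G u \<partial>lborel) = ennreal (r powr (p - 1) / (p - 1))"
    unfolding G_def using p r nn_integral_powr_from_0[of "p - 2" r] by simp
  define m where "m = min r 1"
  have m: "0 < m" "m \<le> 1" "m \<le> r" using r by (auto simp: m_def)
  have Hint: "(\<integral>\<^sup>+v. H v \<partial>lborel) \<le> ennreal (2 * r)"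
  proof -
    have "((\<lambda>v. v powr (-1/2)) has_integral (2 * sqrt 1 - 2 * sqrt (1 - m))) {1 - m..1}"
    proof (rule fundamental_theorem_of_calculus_interior)
      show "((\<lambda>v. 2 * sqrt v) has_vector_derivative v powr (-1/2)) (at v)" if "v \<in> {1 - m<..<1}" for v
        using that m
        by (auto simp: has_real_derivative_iff_has_vector_derivative[symmetric] powr_minus powr_half_sqrt
              intro!: derivative_eq_intros)
    qed (use m in \<open>auto intro!: continuous_intros\<close>)
    hence "(\<integral>\<^sup>+v. H v \<partial>lborel) = ennreal (2 * sqrt 1 - 2 * sqrt (1 - m))"
      unfolding H_def m_def[symmetric] by (intro nn_integral_has_integral_lebesgue') auto
    also have "1 - m \<le> sqrt (1 - m)"
      using m by (intro real_le_rsqrt) (simp add: power2_eq_square mult_left_le)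
    hence "2 * sqrt 1 - 2 * sqrt (1 - m) \<le> 2 * r" using m by simp
    finally show ?thesis by (simp add: ennreal_leI)
  qed
  have [measurable]: "(\<lambda>z. ennreal (disc_weight p z) * indicator (unit_disc \<inter> ball 1 r) z) \<in> borel_measurable borel"
    by (intro measurable_disc_weight) auto
  have "(\<integral>\<^sup>+z. ennreal (disc_weight p z) * indicator (unit_disc \<inter> ball 1 r) z \<partial>lborel)
      \<le> (\<integral>\<^sup>+y. \<integral>\<^sup>+x. H (1 - \<bar>y\<bar>) * G (c y - \<bar>x\<bar>) \<partial>lborel \<partial>lborel)"
    by (subst nn_integral_complex(2)) (auto intro!: nn_integral_mono ptw)
  also have "\<dots> = (\<integral>\<^sup>+y. H (1 - \<bar>y\<bar>) * (\<integral>\<^sup>+x. G (c y - \<bar>x\<bar>) \<partial>lborel) \<partial>lborel)"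
    by (intro nn_integral_cong nn_integral_cmult) measurable
  also have "\<dots> \<le> (\<integral>\<^sup>+y. H (1 - \<bar>y\<bar>) * (2 * (\<integral>\<^sup>+u. G u \<partial>lborel)) \<partial>lborel)"
    by (intro nn_integral_mono mult_left_mono nn_integral_reflect_abs_le) auto
  also have "\<dots> = (\<integral>\<^sup>+y. H (1 - \<bar>y\<bar>) \<partial>lborel) * (2 * (\<integral>\<^sup>+u. G u \<partial>lborel))"
    by (intro nn_integral_multc) measurable
  also have "\<dots> \<le> (2 * ennreal (2 * r)) * (2 * (\<integral>\<^sup>+u. G u \<partial>lborel))"
    by (intro mult_right_mono order.trans[OF nn_integral_reflect_abs_le] mult_left_mono Hint) auto
  also have "\<dots> = ennreal (8 / (p - 1) * (r * r powr (p - 1)))"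
    unfolding Gint using p r by (simp add: ennreal_mult[symmetric] flip: ennreal_numeral)
  also have "r * r powr (p - 1) = r powr p"
    using r powr_add[of r 1 "p - 1"] by simp
  finally show ?thesis .
qed

lemma disc_mass_near_1:
  assumes "1 < p"
  obtains K where "0 \<le> K" "\<And>r. 0 < r \<Longrightarrow>
    (\<integral>\<^sup>+z. ennreal (disc_weight p z) * indicator (unit_disc \<inter> ball 1 r) z \<partial>lborel) \<le> ennreal (K * r powr p)"
proof (cases "p < 2")
  case True
  thus ?thesis using disc_mass_near_1_small_p[OF assms True] assms
    by (intro that[of "8 / (p - 1)"]) auto
next
  case False
  thus ?thesis using disc_mass_near_1_large_p[of p]
    by (intro that[of "2 powr p"]) auto
qed

text \<open>The branch of \<open>log (4 / (1 - z))\<close> that is real on \<open>[0, 1)\<close>. The numerator \<open>4\<close> keeps its real part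
  at least \<open>log 2\<close> on the disc; with numerator \<open>2\<close> the function would tend to \<open>0\<close> at \<open>-1\<close>, and the
  derivatives of its powers with exponents in \<open>(0, 1)\<close> would be unbounded there.\<close>

definition log_sing :: "complex \<Rightarrow> complex" where
  "log_sing z = of_real (ln 4) - Ln (1 - z)"

lemma Re_log_sing:
  assumes "z \<in> unit_disc"
  shows "Re (log_sing z) = ln (4 / cmod (1 - z))" "ln 2 \<le> Re (log_sing z)"
proof -
  have "z \<noteq> 1" using assms by auto
  thus *: "Re (log_sing z) = ln (4 / cmod (1 - z))"
    by (simp add: log_sing_def ln_div)
  have "cmod (1 - z) \<le> 2" using assms norm_triangle_ineq4[of 1 z] by simp
  thus "ln 2 \<le> Re (log_sing z)" unfolding * using \<open>z \<noteq> 1\<close>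
    by (subst ln_le_cancel_iff) (auto simp: field_simps)
qed

lemma log_sing_powr_real:
  assumes "0 \<le> t" "t < 1"
  shows "log_sing (of_real t) powr of_real g = of_real (ln (4 / (1 - t)) powr g)"
proof -
  have "1 - complex_of_real t = of_real (1 - t)" by simp
  hence "log_sing (of_real t) = of_real (ln (4 / (1 - t)))"
    using assms by (simp only: log_sing_def Ln_of_real ln_div) simp
  moreover have "0 < ln (4 / (1 - t))" using assms by (intro ln_gt_zero) (auto simp: field_simps)
  ultimately show ?thesis by (simp add: powr_of_real)
qed

lemma log_sing_powr_deriv:
  assumes "z \<in> unit_disc"
  shows "((\<lambda>z. log_sing z powr of_real g) has_field_derivative
           of_real g * log_sing z powr of_real (g - 1) / (1 - z)) (at z)"
proof -
  have "z \<noteq> 1" "Re z < 1" using assms abs_Re_le_cmod[of z] by auto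
  have "0 < ln (2::real)" by simp
  hence "0 < Re (log_sing z)" using Re_log_sing(2)[OF assms] by linarith
  hence nz: "log_sing z \<notin> \<real>\<^sub>\<le>\<^sub>0" by (auto simp: complex_nonpos_Reals_iff)
  have nz': "1 - z \<notin> \<real>\<^sub>\<le>\<^sub>0" using \<open>Re z < 1\<close> by (auto simp: complex_nonpos_Reals_iff)
  have "(log_sing has_field_derivative 1 / (1 - z)) (at z)"
    unfolding log_sing_def using nz' by (auto intro!: derivative_eq_intros simp: field_simps)
  from DERIV_chain2[OF has_field_derivative_powr[OF nz] this]
  show ?thesis by simp
qed

text \<open>On the shell where \<open>|1 - z| \<sim> 2\<^sup>-\<^sup>n\<close> the derivative is at most of order
  \<open>(n + 1)\<^sup>g\<^sup>-\<^sup>1 2\<^sup>n\<close>. Its \<open>p\<close>-th power times the mass \<open>O(2\<^sup>-\<^sup>n\<^sup>p)\<close> of the shell is \<open>O((n + 1)\<^sup>-\<^sup>q)\<close> with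
  \<open>q = (1 - g) p > 1\<close>.\<close>

lemma log_sing_powr_in_besov_space:
  assumes p: "1 < p" and g: "0 \<le> g" "g < 1 - 1 / p"
  shows "(\<lambda>z. log_sing z powr of_real g) \<in> besov_space p"
proof -
  let ?f = "\<lambda>z. log_sing z powr of_real g"
  obtain K where K: "0 \<le> K" "\<And>r. 0 < r \<Longrightarrow>
    (\<integral>\<^sup>+z. ennreal (disc_weight p z) * indicator (unit_disc \<inter> ball 1 r) z \<partial>lborel) \<le> ennreal (K * r powr p)"
    using disc_mass_near_1[OF p] by blast
  have hol: "?f holomorphic_on unit_disc"
    unfolding holomorphic_on_open[OF open_ball] using log_sing_powr_deriv by blast
  have "0 < 1 / p" using p by simp
  hence g1: "g < 1" using g by linarith
  define q where "q = (1 - g) * p"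
  have q: "1 < q"
  proof -
    have "(1 / p) * p < (1 - g) * p" using p g by (intro mult_strict_right_mono) auto
    thus ?thesis using p by (simp add: q_def)
  qed
  define W where "W = (\<lambda>r z. ennreal (disc_weight p z) * indicator (unit_disc \<inter> ball 1 r) z)"
  have [measurable]: "W r \<in> borel_measurable borel" for r
    unfolding W_def by (intro measurable_disc_weight) auto
  \<comment> \<open>The factor \<open>4\<close> leaves room for a strict inequality \<open>|1 - z| < r n\<close> on the \<open>n\<close>-th shell.\<close>
  define r where "r = (\<lambda>n::nat. 4 * (1/2::real)^n)"
  have r: "0 < r n" for n by (simp add: r_def)
  define a where "a = (\<lambda>n::nat. (real (Suc n) * ln 2) powr (- q) * (4 / r n) powr p)"
  have a0: "0 \<le> a n" for n by (simp add: a_def)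
  have ptw: "ennreal ((1 - (cmod z)\<^sup>2) powr (p - 2) * cmod (deriv ?f z) powr p) * indicator unit_disc z
     \<le> (\<Sum>n. ennreal (a n) * W (r n) z)" for z
  proof (cases "z \<in> unit_disc")
    case True
    define d where "d = cmod (1 - z)"
    have d: "0 < d" "d \<le> 2"
      using True norm_triangle_ineq4[of 1 z] by (auto simp: d_def)
    obtain n where "(1/2)^n / 2 \<le> d / 2" "d / 2 \<le> (1/2)^n"
      using dyadic_index[of "d / 2"] d by auto
    hence dn: "r n / 4 \<le> d" "d \<le> r n / 2"
      by (simp_all add: r_def)
    have dr: "d < r n" using dn r[of n] by linarith
    have L: "real (Suc n) * ln 2 \<le> Re (log_sing z)"
    proof -
      have "real (Suc n) * ln 2 = ln (2 ^ Suc n)" by (simp only: ln_realpow)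
      also have "\<dots> \<le> ln (4 / d)"
        using d dn by (subst ln_le_cancel_iff) (auto simp: r_def field_simps power_one_over)
      finally show ?thesis using Re_log_sing(1)[OF True] by (simp add: d_def)
    qed
    have "cmod (deriv ?f z) = g * cmod (log_sing z) powr (g - 1) / d"
      using g by (simp add: DERIV_imp_deriv[OF log_sing_powr_deriv[OF True]] norm_mult norm_divide norm_powr_real_powr' d_def)
    also have "\<dots> \<le> 1 * (real (Suc n) * ln 2) powr (g - 1) / (r n / 4)"
      using g1 g dn r[of n] L complex_Re_le_cmod[of "log_sing z"]
      by (intro frac_le mult_mono powr_mono2') auto
    finally have "cmod (deriv ?f z) powr p \<le> ((real (Suc n) * ln 2) powr (g - 1) * (4 / r n)) powr p"
      using p by (intro powr_mono2) auto
    also have "\<dots> = a n"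
    proof -
      have "(g - 1) * p = - q" by (simp add: q_def algebra_simps)
      thus ?thesis using r[of n] by (simp only: a_def powr_mult powr_powr)
    qed
    finally have "disc_weight p z * cmod (deriv ?f z) powr p \<le> disc_weight p z * a n"
      by (intro mult_left_mono) (auto simp: disc_weight_def)
    hence "ennreal ((1 - (cmod z)\<^sup>2) powr (p - 2) * cmod (deriv ?f z) powr p) * indicator unit_disc z
        \<le> ennreal (a n) * W (r n) z"
      using True dr a0 by (simp add: W_def dist_norm d_def disc_weight_def mult.commute ennreal_leI flip: ennreal_mult')
    also have "\<dots> \<le> (\<Sum>n. ennreal (a n) * W (r n) z)"
      using sum_le_suminf[of "\<lambda>n. ennreal (a n) * W (r n) z" "{n}"] by simp
    finally show ?thesis .
  qed simp
  have "(\<integral>\<^sup>+ z. ennreal ((1 - (cmod z)\<^sup>2) powr (p - 2) * cmod (deriv ?f z) powr p) * indicator unit_disc z \<partial>lborel)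
     \<le> (\<integral>\<^sup>+ z. (\<Sum>n. ennreal (a n) * W (r n) z) \<partial>lborel)"
    by (intro nn_integral_mono ptw)
  also have "\<dots> = (\<Sum>n. ennreal (a n) * (\<integral>\<^sup>+ z. W (r n) z \<partial>lborel))"
    by (subst nn_integral_suminf) (auto simp: nn_integral_cmult)
  also have "\<dots> \<le> (\<Sum>n. ennreal (a n) * ennreal (K * r n powr p))"
    using K(2)[OF r] by (intro suminf_le mult_left_mono) (auto simp: W_def)
  also have "\<dots> = (\<Sum>n. ennreal (K * 4 powr p * ln 2 powr (- q) * real (Suc n) powr (- q)))"
  proof (intro suminf_cong)
    fix n
    have "(4 / r n) powr p * r n powr p = 4 powr p" using r[of n] by (simp add: powr_divide)
    hence "a n * (K * r n powr p) = K * 4 powr p * ln 2 powr (- q) * real (Suc n) powr (- q)"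
      by (simp add: a_def powr_mult mult_ac)
    thus "ennreal (a n) * ennreal (K * r n powr p) = ennreal (K * 4 powr p * ln 2 powr (- q) * real (Suc n) powr (- q))"
      using ennreal_mult'[OF a0, of n "K * r n powr p"] by metis
  qed
  also have "\<dots> < \<infinity>"
  proof -
    have "summable (\<lambda>n. real (Suc n) powr (- q))"
      using q summable_Suc_iff[of "\<lambda>n. real n powr (- q)"] by (simp add: summable_real_powr_iff)
    hence "summable (\<lambda>n. K * 4 powr p * ln 2 powr (- q) * real (Suc n) powr (- q))"
      by (rule summable_mult)
    thus ?thesis using K(1)
      by (subst suminf_ennreal2) auto
  qed
  finally show ?thesis using hol by (simp add: besov_space_iff besov_density_def)
qed

section \<open>Well-definedness of the operator and logarithmic integrability\<close>

theorem theorem3p3: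
  fixes p p' :: real and \<mu> :: "real measure"
  assumes "1 < p"
    and "1 / p + 1 / p' = 1"
    and "sets \<mu> = sets (restrict_space borel {0..<1})"
  shows "((\<integral>\<^sup>+ t. ennreal (ln (2 / (1 - t)) powr (1 / p')) \<partial>\<mu>) < \<infinity> \<longrightarrow>
            (\<forall>f\<in>besov_space p. I_well_defined \<mu> f)) \<and>
         ((\<forall>f\<in>besov_space p. I_well_defined \<mu> f) \<longrightarrow>
            (\<forall>\<gamma><1 / p'. (\<integral>\<^sup>+ t. ennreal (ln (2 / (1 - t)) powr \<gamma>) \<partial>\<mu>) < \<infinity>))"
proof -
  have p': "1 / p' = 1 - 1 / p" using assms(2) by linarith
  have sp: "space \<mu> = {0..<1}"
    using sets_eq_imp_space_eq[OF assms(3)] by (simp add: space_restrict_space)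
  have meas: "borel_measurable \<mu> = borel_measurable (restrict_space borel {0..<1::real})"
    by (rule measurable_cong_sets[OF assms(3) refl])
  have id: "(\<lambda>t. t) \<in> borel_measurable \<mu>"
    unfolding meas by (intro borel_measurable_continuous_on_restrict continuous_intros)
  have L: "0 < ln (2 / (1 - t))" "ln 2 \<le> ln (2 / (1 - t))" if "t \<in> space \<mu>" for t
    using that by (auto simp: sp field_simps intro!: ln_gt_zero)
  have "I_well_defined \<mu> f"
    if fin: "(\<integral>\<^sup>+ t. ennreal (ln (2 / (1 - t)) powr (1 / p')) \<partial>\<mu>) < \<infinity>" and f: "f \<in> besov_space p" for f
  proof (rule I_well_defined_if_integrable[OF sp _ id])
    obtain C where C: "0 \<le> C"
      "\<And>t. 0 \<le> t \<Longrightarrow> t < 1 \<Longrightarrow> norm (f (of_real t)) \<le> C * ln (2 / (1 - t)) powr (1 - 1 / p)"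
      using besov_growth[OF assms(1) f] by blast
    have hol: "f holomorphic_on unit_disc" using f by (simp add: besov_space_iff)
    show "integrable \<mu> (\<lambda>t. f (of_real t))"
    proof (rule Bochner_Integration.integrable_bound)
      show "integrable \<mu> (\<lambda>t. C * ln (2 / (1 - t)) powr (1 / p'))"
        using fin id by (intro integrable_mult_right integrableI_nonneg) auto
      show "(\<lambda>t. f (of_real t)) \<in> borel_measurable \<mu>"
        unfolding meas
        by (intro borel_measurable_continuous_on_restrict
            continuous_on_compose2[OF holomorphic_on_imp_continuous_on[OF hol]] continuous_intros) auto
      show "AE t in \<mu>. norm (f (of_real t)) \<le> norm (C * ln (2 / (1 - t)) powr (1 / p'))"
        using C by (intro AE_I2) (simp add: sp p')
    qed
  qed
  moreover have "(\<integral>\<^sup>+ t. ennreal (ln (2 / (1 - t)) powr \<gamma>) \<partial>\<mu>) < \<infinity>"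
    if wd: "\<forall>f\<in>besov_space p. I_well_defined \<mu> f" and \<gamma>: "\<gamma> < 1 / p'" for \<gamma>
  proof -
    \<comment> \<open>For \<open>\<gamma> < 0\<close> the integrand is bounded by \<open>(log 2)\<^sup>\<gamma>\<close>, and the test function with exponent \<open>0\<close>, a constant, shows that \<open>\<mu>\<close> is finite.\<close>
    define g where "g = max \<gamma> 0"
    have g: "0 \<le> g" "g < 1 - 1 / p" using \<gamma> assms(1) p' by (auto simp: g_def)
    define K :: real where "K = max 1 (ln 2 powr \<gamma>)"
    let ?f = "\<lambda>z. log_sing z powr of_real g"
    have "I_well_defined \<mu> ?f" using wd log_sing_powr_in_besov_space[OF assms(1) g] by blast
    hence "integrable \<mu> (I_integrand ?f 0)" by (auto simp: I_well_defined_def)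
    hence "integrable \<mu> (\<lambda>t. K * norm (I_integrand ?f 0 t))"
      by (intro integrable_mult_right integrable_norm)
    hence "(\<integral>\<^sup>+ t. ennreal (norm (K * norm (I_integrand ?f 0 t))) \<partial>\<mu>) < \<infinity>"
      by (simp only: integrable_iff_bounded)
    moreover have "(\<integral>\<^sup>+ t. ennreal (ln (2 / (1 - t)) powr \<gamma>) \<partial>\<mu>)
       \<le> (\<integral>\<^sup>+ t. ennreal (norm (K * norm (I_integrand ?f 0 t))) \<partial>\<mu>)"
    proof (intro nn_integral_mono ennreal_leI)
      fix t assume t: "t \<in> space \<mu>"
      hence t': "0 \<le> t" "t < 1" by (auto simp: sp)
      have l0: "0 < ln (4 / (1 - t))" "ln (2 / (1 - t)) \<le> ln (4 / (1 - t))"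
        using t' by (auto simp: field_simps intro!: ln_gt_zero)
      have "ln (2 / (1 - t)) powr \<gamma> \<le> K * ln (4 / (1 - t)) powr g"
      proof (cases "0 \<le> \<gamma>")
        case True
        have "ln (2 / (1 - t)) powr \<gamma> \<le> ln (4 / (1 - t)) powr \<gamma>"
          using L[OF t] l0 True by (intro powr_mono2) auto
        also have "\<dots> = 1 * ln (4 / (1 - t)) powr g" using True by (simp add: g_def)
        also have "\<dots> \<le> K * ln (4 / (1 - t)) powr g" by (intro mult_right_mono) (auto simp: K_def)
        finally show ?thesis .
      next
        case False
        have "ln (2 / (1 - t)) powr \<gamma> \<le> ln 2 powr \<gamma>"
          using L[OF t] False by (intro powr_mono2') auto
        thus ?thesis using False l0 by (simp add: g_def K_def)
      qed
      thus "ln (2 / (1 - t)) powr \<gamma> \<le> norm (K * norm (I_integrand ?f 0 t))"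
        by (simp add: I_integrand_def log_sing_powr_real[OF t'] K_def)
    qed
    ultimately show ?thesis by (rule le_less_trans[rotated])
  qed
  ultimately show ?thesis by blast
qed

end
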